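(* Let $\mathcal C$ be the class of ultimately periodic traces or the class of ultimately constant traces. Then countable satisfiability, $\mathcal C$-restricted satisfiability and $\mathcal C$-restricted finite satisfiability of $\mathrm{LTL}(\sim)$ are logspace-reducible to $\mathbf{\Delta^2_0}$.
   Context: Let $\mathrm{AP}$ be a countably infinite set of atomic propositions. A trace is an infinite sequence $t=t(0)t(1)\cdots\in(\wp\mathrm{AP})^\omega$, and $t^i=t(i)t(i+1)\cdots$. A team is a (possibly empty) set $T$ of traces, and $T^i=\{t^i: t\in T\}$. Formulas of $\mathrm{LTL}(\sim)$ are given by $\varphi::=p\mid\neg\varphi\mid\varphi\wedge\varphi\mid\varphi\vee\varphi\mid\mathsf X\varphi\mid\mathsf F\varphi\mid\mathsf G\varphi\mid\varphi\,\mathsf U\,\varphi\mid\varphi\,\mathsf R\,\varphi\mid{\sim}\varphi$ with $p\in\mathrm{AP}$. Synchronous team semantics: $T\models p$ iff $p\in t(0)$ for all $t\in T$; $T\models\neg\varphi$ iff $\{t\}\not\models\varphi$ for all $t\in T$; $T\models\varphi\wedge\psi$ iff $T\models\varphi$ and $T\models\psi$; $T\models\varphi\vee\psi$ iff $T=S\cup U$ for some $S,U$ with $S\models\varphi$ and $U\models\psi$; $T\models\mathsf X\varphi$ iff $T^1\models\varphi$; $T\models\mathsf F\varphi$ iff $T^k\models\varphi$ for some $k\ge0$; $T\models\mathsf G\varphi$ iff $T^k\models\varphi$ for all $k\ge0$; $T\models\varphi\,\mathsf U\,\psi$ iff there is $k\ge0$ with $T^k\models\psi$ and $T^j\models\varphi$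 for all $j<k$; $T\models\varphi\,\mathsf R\,\psi$ iff for all $k\ge0$, $T^k\models\psi$ or $T^j\models\varphi$ for some $j<k$; $T\models{\sim}\varphi$ iff $T\not\models\varphi$. A finite Kripke structure is $K=(W,R,\eta,r)$ with $W$ finite nonempty, $R\subseteq W\times W$ serial, $\eta:W\to\wp\mathrm{AP}$ with finite labels, and root $r\in W$; a path is $\pi\in W^\omega$ with $\pi(0)=r$ and $(\pi(i),\pi(i+1))\in R$; it induces the trace $(\eta(\pi(i)))_{i\ge0}$; $T(K)$ is the team of all induced traces. A trace $t$ is ultimately periodic if there are $c,d>0$ with $t(n)=t(n+d)$ for all $n\ge c$, and ultimately constant if some suffix $t^i$ is constant. Countable satisfiability: formulas satisfied by some countable team. For a class $\mathcal C$ of traces, $\mathcal C$-restricted satisfiability is the set of $\varphi$ such that $T\cap\mathcal C\models\varphi$ for some team $T$; $\mathcal C$-restricted finite satisfiability is the set of $\varphi$ such that $T(K)\cap\mathcal C\models\varphi$ for some finite Kripke structure $K$. $\mathbf{\Delta^2_0}$ denotes the set of closed formulas of second-order arithmetic (vocabulary $+,\times,0,1,=,\le$; first-order variables over $\mathbb N$, second-order variables of arity $n$ over subsets of $\mathbb N^n$) true in the standard model $\mathbb N$. *)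

theory Defs
  imports Main "HOL-Library.Countable_Set"
begin

text \<open>Atomic propositions: AP = nat (a countably infinite set).
  A trace is an infinite sequence of sets of atomic propositions.\<close>

type_synonym trace = "nat \<Rightarrow> nat set"

datatype ltl =
    LAtom nat
  | LNeg ltl
  | LAnd ltl ltl
  | LOr ltl ltl
  | LX ltl
  | LF ltl
  | LG ltl
  | LU ltl ltl
  | LR ltl ltl
  | LTilde ltl

definition tsuffix :: "nat \<Rightarrow> trace \<Rightarrow> trace" where
  "tsuffix k t = (\<lambda>i. t (i + k))"

definition team_suffix :: "nat \<Rightarrow> trace set \<Rightarrow> trace set" where
  "team_suffix k T = tsuffix k ` T"

primrec tsat :: "trace set \<Rightarrow> ltl \<Rightarrow> bool" where
  "tsat T (LAtom p) = (\<forall>t\<in>T. p \<in> t 0)"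
| "tsat T (LNeg \<phi>) = (\<forall>t\<in>T. \<not> tsat {t} \<phi>)"
| "tsat T (LAnd \<phi> \<psi>) = (tsat T \<phi> \<and> tsat T \<psi>)"
| "tsat T (LOr \<phi> \<psi>) = (\<exists>S U. T = S \<union> U \<and> tsat S \<phi> \<and> tsat U \<psi>)"
| "tsat T (LX \<phi>) = tsat (team_suffix 1 T) \<phi>"
| "tsat T (LF \<phi>) = (\<exists>k. tsat (team_suffix k T) \<phi>)"
| "tsat T (LG \<phi>) = (\<forall>k. tsat (team_suffix k T) \<phi>)"
| "tsat T (LU \<phi> \<psi>) = (\<exists>k. tsat (team_suffix k T) \<psi> \<and> (\<forall>j<k. tsat (team_suffix j T) \<phi>))"
| "tsat T (LR \<phi> \<psi>) = (\<forall>k. tsat (team_suffix k T) \<psi> \<or> (\<exists>j<k. tsat (team_suffix j T) \<phi>))"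
| "tsat T (LTilde \<phi>) = (\<not> tsat T \<phi>)"

definition ultimately_periodic :: "trace \<Rightarrow> bool" where
  "ultimately_periodic t = (\<exists>c d. c > 0 \<and> d > 0 \<and> (\<forall>n\<ge>c. t n = t (n + d)))"

definition ultimately_constant :: "trace \<Rightarrow> bool" where
  "ultimately_constant t = (\<exists>i. \<forall>n\<ge>i. t n = t i)"

definition kripke :: "nat set \<Rightarrow> (nat \<times> nat) set \<Rightarrow> (nat \<Rightarrow> nat set) \<Rightarrow> nat \<Rightarrow> bool" where
  "kripke W R \<eta> r =
     (finite W \<and> W \<noteq> {} \<and> R \<subseteq> W \<times> W \<and> (\<forall>w\<in>W. \<exists>v. (w, v) \<in> R)
      \<and> (\<forall>w\<in>W. finite (\<eta> w)) \<and> r \<in> W)"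

definition kpaths :: "(nat \<times> nat) set \<Rightarrow> nat \<Rightarrow> (nat \<Rightarrow> nat) set" where
  "kpaths R r = {\<pi>. \<pi> 0 = r \<and> (\<forall>i. (\<pi> i, \<pi> (Suc i)) \<in> R)}"

definition kteam :: "(nat \<times> nat) set \<Rightarrow> (nat \<Rightarrow> nat set) \<Rightarrow> nat \<Rightarrow> trace set" where
  "kteam R \<eta> r = {(\<lambda>i. \<eta> (\<pi> i)) | \<pi>. \<pi> \<in> kpaths R r}"

definition countable_sat :: "ltl set" where
  "countable_sat = {\<phi>. \<exists>T. countable T \<and> tsat T \<phi>}"

definition restricted_sat :: "trace set \<Rightarrow> ltl set" where
  "restricted_sat C = {\<phi>. \<exists>T. tsat (T \<inter> C) \<phi>}"

definition restricted_fin_sat :: "trace set \<Rightarrow> ltl set" where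
  "restricted_fin_sat C =
     {\<phi>. \<exists>W R \<eta> r. kripke W R \<eta> r \<and> tsat (kteam R \<eta> r \<inter> C) \<phi>}"

datatype aterm = AVar nat | AZero | AOne | APlus aterm aterm | ATimes aterm aterm

text \<open>Second-order variables are pairs (name, arity); SApp X ts applies the
  variable (X, length ts).  SEx2 X n binds the variable (X, n).\<close>

datatype soform =
    SEq aterm aterm
  | SLe aterm aterm
  | SApp nat "aterm list"
  | SNot soform
  | SAnd soform soform
  | SOr soform soform
  | SEx1 nat soform
  | SAll1 nat soform
  | SEx2 nat nat soform
  | SAll2 nat nat soform

primrec aeval :: "(nat \<Rightarrow> nat) \<Rightarrow> aterm \<Rightarrow> nat" where
  "aeval \<sigma> (AVar x) = \<sigma> x"
| "aeval \<sigma> AZero = 0"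
| "aeval \<sigma> AOne = 1"
| "aeval \<sigma> (APlus s t) = aeval \<sigma> s + aeval \<sigma> t"
| "aeval \<sigma> (ATimes s t) = aeval \<sigma> s * aeval \<sigma> t"

primrec asat :: "(nat \<Rightarrow> nat) \<Rightarrow> (nat \<Rightarrow> nat \<Rightarrow> nat list set) \<Rightarrow> soform \<Rightarrow> bool" where
  "asat \<sigma> \<rho> (SEq s t) = (aeval \<sigma> s = aeval \<sigma> t)"
| "asat \<sigma> \<rho> (SLe s t) = (aeval \<sigma> s \<le> aeval \<sigma> t)"
| "asat \<sigma> \<rho> (SApp X ts) = (map (aeval \<sigma>) ts \<in> \<rho> X (length ts))"
| "asat \<sigma> \<rho> (SNot \<phi>) = (\<not> asat \<sigma> \<rho> \<phi>)"
| "asat \<sigma> \<rho> (SAnd \<phi> \<psi>) = (asat \<sigma> \<rho> \<phi> \<and> asat \<sigma> \<rho> \<psi>)"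
| "asat \<sigma> \<rho> (SOr \<phi> \<psi>) = (asat \<sigma> \<rho> \<phi> \<or> asat \<sigma> \<rho> \<psi>)"
| "asat \<sigma> \<rho> (SEx1 x \<phi>) = (\<exists>m. asat (\<sigma>(x := m)) \<rho> \<phi>)"
| "asat \<sigma> \<rho> (SAll1 x \<phi>) = (\<forall>m. asat (\<sigma>(x := m)) \<rho> \<phi>)"
| "asat \<sigma> \<rho> (SEx2 X n \<phi>) =
     (\<exists>S. S \<subseteq> {xs. length xs = n} \<and> asat \<sigma> (\<rho>(X := (\<rho> X)(n := S))) \<phi>)"
| "asat \<sigma> \<rho> (SAll2 X n \<phi>) =
     (\<forall>S. S \<subseteq> {xs. length xs = n} \<longrightarrow> asat \<sigma> (\<rho>(X := (\<rho> X)(n := S))) \<phi>)"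

primrec avars :: "aterm \<Rightarrow> nat set" where
  "avars (AVar x) = {x}"
| "avars AZero = {}"
| "avars AOne = {}"
| "avars (APlus s t) = avars s \<union> avars t"
| "avars (ATimes s t) = avars s \<union> avars t"

primrec fv1 :: "soform \<Rightarrow> nat set" where
  "fv1 (SEq s t) = avars s \<union> avars t"
| "fv1 (SLe s t) = avars s \<union> avars t"
| "fv1 (SApp X ts) = (\<Union>t\<in>set ts. avars t)"
| "fv1 (SNot \<phi>) = fv1 \<phi>"
| "fv1 (SAnd \<phi> \<psi>) = fv1 \<phi> \<union> fv1 \<psi>"
| "fv1 (SOr \<phi> \<psi>) = fv1 \<phi> \<union> fv1 \<psi>"
| "fv1 (SEx1 x \<phi>) = fv1 \<phi> - {x}"
| "fv1 (SAll1 x \<phi>) = fv1 \<phi> - {x}"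
| "fv1 (SEx2 X n \<phi>) = fv1 \<phi>"
| "fv1 (SAll2 X n \<phi>) = fv1 \<phi>"

primrec fv2 :: "soform \<Rightarrow> (nat \<times> nat) set" where
  "fv2 (SEq s t) = {}"
| "fv2 (SLe s t) = {}"
| "fv2 (SApp X ts) = {(X, length ts)}"
| "fv2 (SNot \<phi>) = fv2 \<phi>"
| "fv2 (SAnd \<phi> \<psi>) = fv2 \<phi> \<union> fv2 \<psi>"
| "fv2 (SOr \<phi> \<psi>) = fv2 \<phi> \<union> fv2 \<psi>"
| "fv2 (SEx1 x \<phi>) = fv2 \<phi>"
| "fv2 (SAll1 x \<phi>) = fv2 \<phi>"
| "fv2 (SEx2 X n \<phi>) = fv2 \<phi> - {(X, n)}"
| "fv2 (SAll2 X n \<phi>) = fv2 \<phi> - {(X, n)}"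

primrec pos_arities :: "soform \<Rightarrow> bool" where
  "pos_arities (SEq s t) = True"
| "pos_arities (SLe s t) = True"
| "pos_arities (SApp X ts) = (ts \<noteq> [])"
| "pos_arities (SNot \<phi>) = pos_arities \<phi>"
| "pos_arities (SAnd \<phi> \<psi>) = (pos_arities \<phi> \<and> pos_arities \<psi>)"
| "pos_arities (SOr \<phi> \<psi>) = (pos_arities \<phi> \<and> pos_arities \<psi>)"
| "pos_arities (SEx1 x \<phi>) = pos_arities \<phi>"
| "pos_arities (SAll1 x \<phi>) = pos_arities \<phi>"
| "pos_arities (SEx2 X n \<phi>) = (n \<ge> 1 \<and> pos_arities \<phi>)"
| "pos_arities (SAll2 X n \<phi>) = (n \<ge> 1 \<and> pos_arities \<phi>)"

definition closed_so :: "soform \<Rightarrow> bool" where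
  "closed_so \<phi> = (fv1 \<phi> = {} \<and> fv2 \<phi> = {} \<and> pos_arities \<phi>)"

text \<open>\<Delta>^2_0: closed sentences true in the standard model (the assignment is
  irrelevant for closed formulas).\<close>
definition Delta20 :: "soform set" where
  "Delta20 = {\<phi>. closed_so \<phi> \<and> asat (\<lambda>_. 0) (\<lambda>_ _. {}) \<phi>}"

fun bin :: "nat \<Rightarrow> nat list" where
  "bin n = (if n = 0 then [] else bin (n div 2) @ [n mod 2])"

primrec enc_ltl :: "ltl \<Rightarrow> nat list" where
  "enc_ltl (LAtom p) = 2 # bin p @ [3]"
| "enc_ltl (LNeg \<phi>) = 4 # enc_ltl \<phi>"
| "enc_ltl (LAnd \<phi> \<psi>) = 5 # enc_ltl \<phi> @ enc_ltl \<psi>"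
| "enc_ltl (LOr \<phi> \<psi>) = 6 # enc_ltl \<phi> @ enc_ltl \<psi>"
| "enc_ltl (LX \<phi>) = 7 # enc_ltl \<phi>"
| "enc_ltl (LF \<phi>) = 8 # enc_ltl \<phi>"
| "enc_ltl (LG \<phi>) = 9 # enc_ltl \<phi>"
| "enc_ltl (LU \<phi> \<psi>) = 10 # enc_ltl \<phi> @ enc_ltl \<psi>"
| "enc_ltl (LR \<phi> \<psi>) = 11 # enc_ltl \<phi> @ enc_ltl \<psi>"
| "enc_ltl (LTilde \<phi>) = 12 # enc_ltl \<phi>"

primrec enc_term :: "aterm \<Rightarrow> nat list" where
  "enc_term (AVar x) = 2 # bin x @ [3]"
| "enc_term AZero = [4]"
| "enc_term AOne = [5]"
| "enc_term (APlus s t) = 6 # enc_term s @ enc_term t"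
| "enc_term (ATimes s t) = 7 # enc_term s @ enc_term t"

primrec enc_so :: "soform \<Rightarrow> nat list" where
  "enc_so (SEq s t) = 8 # enc_term s @ enc_term t"
| "enc_so (SLe s t) = 9 # enc_term s @ enc_term t"
| "enc_so (SApp X ts) = 10 # bin X @ [3] @ concat (map enc_term ts) @ [11]"
| "enc_so (SNot \<phi>) = 12 # enc_so \<phi>"
| "enc_so (SAnd \<phi> \<psi>) = 13 # enc_so \<phi> @ enc_so \<psi>"
| "enc_so (SOr \<phi> \<psi>) = 14 # enc_so \<phi> @ enc_so \<psi>"
| "enc_so (SEx1 x \<phi>) = 15 # bin x @ [3] @ enc_so \<phi>"
| "enc_so (SAll1 x \<phi>) = 16 # bin x @ [3] @ enc_so \<phi>"
| "enc_so (SEx2 X n \<phi>) = 17 # bin X @ [3] @ bin n @ [3] @ enc_so \<phi>"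
| "enc_so (SAll2 X n \<phi>) = 18 # bin X @ [3] @ bin n @ [3] @ enc_so \<phi>"

text \<open>A deterministic transducer with a two-way read-only input tape (with
  end markers), one work tape, and a one-way write-only output tape.
  Transition function: (state, input symbol, work symbol) \<mapsto>
  (new state, written work symbol, input move, work move, output).
  Start state 0, halting state 1.  The input symbol read at position i is
  0 (left marker, i = 0), 1 (right marker, i = |w|+1), or w!(i-1)+2.\<close>

datatype move = MvL | MvN | MvR

type_synonym trans = "nat \<Rightarrow> nat \<Rightarrow> nat \<Rightarrow> nat \<times> nat \<times> move \<times> move \<times> nat option"

type_synonym config = "nat \<times> nat \<times> (nat \<Rightarrow> nat) \<times> nat \<times> nat list"

definition in_sym :: "nat list \<Rightarrow> nat \<Rightarrow> nat" where
  "in_sym w i = (if i = 0 then 0 else if i \<le> length w then w ! (i - 1) + 2 else 1)"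

definition mv_in :: "nat \<Rightarrow> move \<Rightarrow> nat \<Rightarrow> nat" where
  "mv_in n m i = (case m of MvL \<Rightarrow> i - 1 | MvN \<Rightarrow> i | MvR \<Rightarrow> min (n + 1) (i + 1))"

definition mv_w :: "move \<Rightarrow> nat \<Rightarrow> nat" where
  "mv_w m j = (case m of MvL \<Rightarrow> j - 1 | MvN \<Rightarrow> j | MvR \<Rightarrow> j + 1)"

definition tm_step :: "trans \<Rightarrow> nat list \<Rightarrow> config \<Rightarrow> config" where
  "tm_step \<delta> w c = (case c of (q, i, tp, j, out) \<Rightarrow>
     if q = 1 then c
     else (case \<delta> q (in_sym w i) (tp j) of (q', b, mi, mw, ot) \<Rightarrow>
       (q', mv_in (length w) mi i, tp(j := b), mv_w mw j,
        out @ (case ot of None \<Rightarrow> [] | Some s \<Rightarrow> [s]))))"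

definition tm_init :: config where
  "tm_init = (0, 0, (\<lambda>_. 0), 0, [])"

definition tm_run :: "trans \<Rightarrow> nat list \<Rightarrow> nat \<Rightarrow> config" where
  "tm_run \<delta> w n = (tm_step \<delta> w ^^ n) tm_init"

definition cstate :: "config \<Rightarrow> nat" where "cstate c = fst c"
definition cwpos :: "config \<Rightarrow> nat" where "cwpos c = fst (snd (snd (snd c)))"
definition cout :: "config \<Rightarrow> nat list" where "cout c = snd (snd (snd (snd c)))"

text \<open>Finitely many states (< Q) and work symbols (< \<Gamma>, blank 0);
  work-head position bounded by c \<cdot> log2(|w|+2) at every step;
  the machine halts on every input with output f w.\<close>
definition logspace_computable :: "(nat list \<Rightarrow> nat list) \<Rightarrow> bool" where
  "logspace_computable f =
    (\<exists>\<delta> Q \<Gamma> c. 1 < Q \<and> 0 < \<Gamma> \<and>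
       (\<forall>q a g. q < Q \<longrightarrow> g < \<Gamma> \<longrightarrow>
           fst (\<delta> q a g) < Q \<and> fst (snd (\<delta> q a g)) < \<Gamma>) \<and>
       (\<forall>w n. 2 ^ cwpos (tm_run \<delta> w n) \<le> (length w + 2) ^ c) \<and>
       (\<forall>w. \<exists>n. cstate (tm_run \<delta> w n) = 1 \<and> cout (tm_run \<delta> w n) = f w))"

definition logspace_reducible :: "nat list set \<Rightarrow> nat list set \<Rightarrow> bool" where
  "logspace_reducible A B = (\<exists>f. logspace_computable f \<and> (\<forall>w. w \<in> A \<longleftrightarrow> f w \<in> B))"

end

theory Submission
  imports Defs
begin

text \<open>Modulo the finitely many atoms of a formula, the teams in question are countable: there are only
  countably many ultimately periodic traces over a finite alphabet. A countable team is a set of indices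
  together with a ternary relation, so team semantics unfolds into second-order arithmetic, with splitting
  as quantification over index sets and time as a number variable.

  Both syntaxes are written in prefix notation. By rebinding the same few variables, every connective can be
  translated to a fixed block of symbols, so that a one-way finite-state transducer, which needs no work
  tape, computes the reduction. It need not check its input: by unique readability, an ill-formed word is
  mapped to an ill-formed word.\<close>

subsection \<open>Finite-state transducers as logspace machines\<close>

text \<open>Prefix notation puts the codes of two operands side by side, so no symbol can be emitted
  between them. A binary connective therefore sets up the environment of its right operand for both,
  and a further block in front of the left operand alone rebinds team or time; its effect ends with
  the scope of that operand. Atoms are unbounded numbers, so their bits, most significant first,
  become Horner steps on a number variable. Over infinitely many propositions even the constant
  traces are uncountable. For restricted satisfiability, labels are cut down to the atoms of the
  formula, which preserves truth and stays in the class. Cutting labels of a Kripke structure could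
  bring new traces into the class; there, finitely many worlds with finite labels give countability
  directly.\<close>

primrec fst_run :: "(nat \<Rightarrow> nat \<Rightarrow> nat) \<Rightarrow> (nat \<Rightarrow> nat \<Rightarrow> nat list) \<Rightarrow> nat list \<Rightarrow> nat \<Rightarrow> nat list" where
  "fst_run nx out [] m = []"
| "fst_run nx out (a # w) m = out m a @ fst_run nx out w (nx m a)"

text \<open>State \<open>st L m j\<close>: in mode \<open>m\<close>, after \<open>j\<close> symbols of the current output block. The head rests on
  the input cell until the block is written, so the block itself need not be remembered.\<close>

definition st :: "nat \<Rightarrow> nat \<Rightarrow> nat \<Rightarrow> nat" where
  "st L m j = (let v = m * Suc L + j in if v = 0 then 0 else Suc v)"

text \<open>Code 1 is skipped by \<open>st\<close> because it is the halting state. Truncated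
  subtraction closes the gap and still sends the start state 0 to 0.\<close>

definition st_mode :: "nat \<Rightarrow> nat \<Rightarrow> nat" where "st_mode L q = (q - 1) div Suc L"
definition st_pos :: "nat \<Rightarrow> nat \<Rightarrow> nat" where "st_pos L q = (q - 1) mod Suc L"

text \<open>The left end marker acts as a letter whose block is the fixed prefix \<open>b0\<close>;
  symbols of the word arrive shifted by 2.\<close>

definition fst_block :: "nat list \<Rightarrow> (nat \<Rightarrow> nat \<Rightarrow> nat list) \<Rightarrow> nat \<Rightarrow> nat \<Rightarrow> nat list" where
  "fst_block b0 out m s = (if s = 0 then b0 else if s = 1 then [] else out m (s - 2))"

definition fst_trans ::
  "nat \<Rightarrow> nat list \<Rightarrow> (nat \<Rightarrow> nat \<Rightarrow> nat) \<Rightarrow> (nat \<Rightarrow> nat \<Rightarrow> nat list) \<Rightarrow> trans" where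
  "fst_trans L b0 nx out q s g =
    (let m = st_mode L q; j = st_pos L q; b = fst_block b0 out m s in
     if j < length b then (st L m (Suc j), 0, MvN, MvN, Some (b ! j))
     else if s = 0 then (st L 0 0, 0, MvR, MvN, None)
     else if s = 1 then (1, 0, MvN, MvN, None)
     else (st L (nx m (s - 2)) 0, 0, MvR, MvN, None))"

lemma st_neq_1 [simp]: "st L m j \<noteq> 1" "st L m j \<noteq> Suc 0"
  by (auto simp: st_def Let_def)

lemma st_0 [simp]: "st L 0 0 = 0"
  by (simp add: st_def)

lemma st_decode [simp]:
  assumes "j \<le> L"
  shows "st_mode L (st L m j) = m" and "st_pos L (st L m j) = j"
proof -
  have *: "st L m j - 1 = m * Suc L + j"
    by (auto simp: st_def Let_def)
  show "st_mode L (st L m j) = m" "st_pos L (st L m j) = j"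
    unfolding st_mode_def st_pos_def * using assms by (simp_all del: mult_Suc_right)
qed

lemma st_less:
  assumes "m < M" "j \<le> L"
  shows "st L m j < Suc (M * Suc L)"
proof -
  have "m * Suc L + j < Suc m * Suc L" using assms by simp
  also have "\<dots> \<le> M * Suc L" using assms by (intro mult_le_mono1) simp
  finally show ?thesis by (auto simp: st_def Let_def)
qed

locale finite_transducer =
  fixes M L :: nat and b0 :: "nat list"
    and nx :: "nat \<Rightarrow> nat \<Rightarrow> nat" and out :: "nat \<Rightarrow> nat \<Rightarrow> nat list"
  assumes M_pos: "0 < M"
    and nx_less: "\<And>m a. m < M \<Longrightarrow> nx m a < M"
    and b0_length: "length b0 \<le> L"
    and out_length: "\<And>m a. length (out m a) \<le> L"
begin

abbreviation "\<delta> \<equiv> fst_trans L b0 nx out"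

lemma block_length: "length (fst_block b0 out m s) \<le> L"
  using b0_length out_length by (auto simp: fst_block_def)

lemma emit:
  assumes "b = fst_block b0 out m (in_sym w i)" and "k \<le> length b"
  shows "(tm_step \<delta> w ^^ k) (st L m 0, i, (\<lambda>_. 0), 0, o') = (st L m k, i, (\<lambda>_. 0), 0, o' @ take k b)"
  using assms(2)
proof (induction k)
  case (Suc k)
  have "k \<le> L" using Suc.prems block_length[of m "in_sym w i"] assms(1) by simp
  then show ?case using Suc assms(1)
    by (simp add: tm_step_def fst_trans_def Let_def mv_in_def mv_w_def fun_upd_idem take_Suc_conv_app_nth)
qed simp

lemma emit_then:
  assumes "b = fst_block b0 out m (in_sym w i)"
  shows "(tm_step \<delta> w ^^ Suc (length b)) (st L m 0, i, (\<lambda>_. 0), 0, o') =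
    (if in_sym w i = 1 then 1
     else st L (if in_sym w i = 0 then 0 else nx m (in_sym w i - 2)) 0,
     if in_sym w i = 1 then i else min (length w + 1) (i + 1), (\<lambda>_. 0), 0, o' @ b)"
proof -
  have "length b \<le> L" using assms block_length by simp
  then show ?thesis
    using emit[OF assms order_refl, of o'] assms
    by (simp add: tm_step_def fst_trans_def Let_def mv_in_def mv_w_def fun_upd_idem)
qed

lemma run_to_end:
  assumes "u @ v = w"
  shows "\<exists>n i. (tm_step \<delta> w ^^ n) (st L m 0, Suc (length u), (\<lambda>_. 0), 0, o') =
    (1, i, (\<lambda>_. 0), 0, o' @ fst_run nx out v m)"
  using assms
proof (induction v arbitrary: u m o')
  case Nil
  then have "in_sym w (Suc (length u)) = 1" by (auto simp: in_sym_def)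
  then show ?case
    using emit_then[OF refl, of m w "Suc (length u)" o']
    by (auto simp: fst_block_def simp del: funpow.simps)
next
  case (Cons a v)
  have s: "in_sym w (Suc (length u)) = a + 2"
    using Cons.prems by (auto simp: in_sym_def nth_append)
  obtain n i where n: "(tm_step \<delta> w ^^ n) (st L (nx m a) 0, Suc (length (u @ [a])), (\<lambda>_. 0), 0, o' @ out m a) =
    (1, i, (\<lambda>_. 0), 0, (o' @ out m a) @ fst_run nx out v (nx m a))"
    using Cons.IH[of "u @ [a]" "nx m a" "o' @ out m a"] Cons.prems by auto
  have "length u + 2 \<le> length w + 1" using Cons.prems by auto
  then have "(tm_step \<delta> w ^^ Suc (length (out m a))) (st L m 0, Suc (length u), (\<lambda>_. 0), 0, o') =
     (st L (nx m a) 0, Suc (length (u @ [a])), (\<lambda>_. 0), 0, o' @ out m a)"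
    using emit_then[of "out m a" m w "Suc (length u)" o'] s
    by (auto simp: fst_block_def simp del: funpow.simps)
  with n have "(tm_step \<delta> w ^^ (n + Suc (length (out m a)))) (st L m 0, Suc (length u), (\<lambda>_. 0), 0, o') =
    (1, i, (\<lambda>_. 0), 0, o' @ fst_run nx out (a # v) m)"
    by (simp only: funpow_add o_apply) simp
  then show ?case by blast
qed

lemma halts: "\<exists>n. cstate (tm_run \<delta> w n) = 1 \<and> cout (tm_run \<delta> w n) = b0 @ fst_run nx out w 0"
proof -
  have "(tm_step \<delta> w ^^ Suc (length b0)) tm_init = (st L 0 0, Suc 0, (\<lambda>_. 0), 0, b0)"
    using emit_then[of b0 0 w 0 "[]"]
    by (simp add: fst_block_def in_sym_def tm_init_def del: funpow.simps)
  moreover obtain n i where "(tm_step \<delta> w ^^ n) (st L 0 0, Suc 0, (\<lambda>_. 0), 0, b0) =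
    (1, i, (\<lambda>_. 0), 0, b0 @ fst_run nx out w 0)"
    using run_to_end[of "[]" w w 0 b0] by auto
  ultimately have "tm_run \<delta> w (n + Suc (length b0)) = (1, i, (\<lambda>_. 0), 0, b0 @ fst_run nx out w 0)"
    unfolding tm_run_def by (simp only: funpow_add o_apply)
  then show ?thesis by (metis cstate_def cout_def fst_conv snd_conv)
qed

lemma work_head_fixed: "cwpos (tm_run \<delta> w n) = 0"
proof -
  have "cwpos (tm_step \<delta> w c) = 0" if "cwpos c = 0" for c
    using that
    by (cases c) (auto simp: tm_step_def cwpos_def mv_w_def fst_trans_def Let_def)
  then show ?thesis
    by (induction n) (simp_all add: tm_run_def tm_init_def, simp add: cwpos_def)
qed

lemma trans_less:
  assumes "q < Suc (M * Suc L)"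
  shows "fst (\<delta> q s g) < Suc (M * Suc L)"
proof -
  have "q - 1 < M * Suc L" using assms M_pos by (cases q) auto
  then have "st_mode L q < M"
    unfolding st_mode_def by (simp add: less_mult_imp_div_less)
  moreover have "Suc (st_pos L q) \<le> L" if "st_pos L q < length (fst_block b0 out m s)" for m
    using that block_length[of m s] by simp
  ultimately show ?thesis
    using st_less[of _ M _ L] nx_less M_pos
    by (force simp: fst_trans_def Let_def intro: less_trans[OF st_less] less_SucI)
qed

theorem logspace: "logspace_computable (\<lambda>w. b0 @ fst_run nx out w 0)"
  unfolding logspace_computable_def
\<comment> \<open>The blank is the only work symbol, and the exponent is 0 because the work head
  stays in cell 0.\<close>
proof (rule exI[of _ \<delta>], rule exI[of _ "Suc (M * Suc L)"], rule exI[of _ 1], rule exI[of _ 0],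
    intro conjI allI impI)
  show "1 < Suc (M * Suc L)" and "(0::nat) < 1" using M_pos by simp_all
  show "fst (\<delta> q a g) < Suc (M * Suc L)" if "q < Suc (M * Suc L)" for q a g
    using trans_less that .
  show "fst (snd (\<delta> q a g)) < 1" for q a g
    by (simp add: fst_trans_def Let_def)
  show "2 ^ cwpos (tm_run \<delta> w n) \<le> (length w + 2) ^ 0" for w n
    by (simp add: work_head_fixed)
  show "\<exists>n. cstate (tm_run \<delta> w n) = 1 \<and> cout (tm_run \<delta> w n) = b0 @ fst_run nx out w 0" for w
    by (rule halts)
qed

end

subsection \<open>Unique readability of encoded formulas\<close>

declare bin.simps [simp del]

abbreviation horner :: "nat \<Rightarrow> nat list \<Rightarrow> nat" where
  "horner \<equiv> foldl (\<lambda>v b. 2 * v + b)"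

lemma bin_0 [simp]: "bin 0 = []"
  by (simp add: bin.simps)

lemma bin_pos: "n > 0 \<Longrightarrow> bin n = bin (n div 2) @ [n mod 2]"
  by (subst bin.simps) simp

lemma horner_bin: "horner 0 (bin n) = n"
proof (induction n rule: less_induct)
  case (less n)
  then show ?case by (cases "n = 0") (simp_all add: bin_pos)
qed

lemma bin_bits: "set (bin n) \<subseteq> {0, 1}"
proof (induction n rule: less_induct)
  case (less n)
  then show ?case
    by (cases "n = 0") (auto simp: bin_pos)
qed

lemma bin_canonical: "bin n = [] \<or> hd (bin n) = 1"
proof (induction n rule: less_induct)
  case (less n)
  show ?case
  proof (cases "n < 2")
    case True
    then have "n = 0 \<or> n = 1" by auto
    then show ?thesis by (auto simp: bin_pos)
  next
    case False
    then have "bin (n div 2) \<noteq> []" by (simp add: bin_pos)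
    then show ?thesis using less[of "n div 2"] False bin_pos[of n] by simp
  qed
qed

text \<open>With \<open>horner_bin\<close> this singles out the codes of numbers among bit strings
  as those without a leading zero; decoding an accepted atom rests on it.\<close>

lemma bin_horner:
  assumes "set bs \<subseteq> {0, 1}" "bs = [] \<or> hd bs = 1"
  shows "bin (horner 0 bs) = bs"
  using assms
proof (induction bs rule: rev_induct)
  case (snoc b bs)
  show ?case
  proof (cases "bs = []")
    case True
    then show ?thesis using snoc.prems by (simp add: bin_pos)
  next
    case False
    then have IH: "bin (horner 0 bs) = bs" using snoc by auto
    then have "horner 0 bs > 0" using False by (cases "horner 0 bs = 0") auto
    then show ?thesis using snoc.prems IH by (auto simp: bin_pos)
  qed
qed simp

lemma bin_delim_cancel:
  assumes "bin m @ 3 # r = bin n @ 3 # r'"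
  shows "m = n \<and> r = r'"
proof -
  have *: "takeWhile (\<lambda>x. x \<noteq> 3) (bin k @ 3 # z) = bin k" for k :: nat and z
    using bin_bits[of k] by (subst takeWhile_append2) auto
  have "bin m = bin n" using *[of m r] *[of n r'] assms by simp
  then have "m = n" by (metis horner_bin)
  then show ?thesis using assms by simp
qed

text \<open>Prefix-freeness, with arbitrary tails: the code of a second argument becomes part of the
  tail of the first, which lets the induction pass binary constructors.\<close>

lemma enc_term_cancel: "enc_term s @ r = enc_term t @ r' \<Longrightarrow> s = t \<and> r = r'"
proof (induction s arbitrary: t r r')
  case (AVar x) then show ?case by (cases t) (auto dest: bin_delim_cancel)
next
  case AZero then show ?case by (cases t) auto
next
  case AOne then show ?case by (cases t) auto
next
  case (APlus s1 s2)
  from APlus.prems obtain t1 t2 where t: "t = APlus t1 t2" by (cases t) auto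
  with APlus.prems have "enc_term s1 @ enc_term s2 @ r = enc_term t1 @ enc_term t2 @ r'" by simp
  then have 1: "s1 = t1 \<and> enc_term s2 @ r = enc_term t2 @ r'" by (rule APlus.IH(1))
  then have "s2 = t2 \<and> r = r'" by (intro APlus.IH(2)) simp
  with 1 t show ?case by simp
next
  case (ATimes s1 s2)
  from ATimes.prems obtain t1 t2 where t: "t = ATimes t1 t2" by (cases t) auto
  with ATimes.prems have "enc_term s1 @ enc_term s2 @ r = enc_term t1 @ enc_term t2 @ r'" by simp
  then have 1: "s1 = t1 \<and> enc_term s2 @ r = enc_term t2 @ r'" by (rule ATimes.IH(1))
  then have "s2 = t2 \<and> r = r'" by (intro ATimes.IH(2)) simp
  with 1 t show ?case by simp
qed

lemma enc_term_Cons: "\<exists>a z. enc_term t = a # z \<and> a \<noteq> 11"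
  by (cases t) auto

lemma enc_terms_cancel:
  "concat (map enc_term ss) @ 11 # r = concat (map enc_term ts) @ 11 # r' \<Longrightarrow> ss = ts \<and> r = r'"
proof (induction ss arbitrary: ts)
  case Nil
  then show ?case
    using enc_term_Cons[of "hd ts"] by (cases ts) auto
next
  case (Cons s ss)
  from Cons.prems obtain t ts' where ts: "ts = t # ts'"
    using enc_term_Cons[of s] by (cases ts) auto
  with Cons.prems have
    "enc_term s @ concat (map enc_term ss) @ 11 # r = enc_term t @ concat (map enc_term ts') @ 11 # r'"
    by simp
  then have 1: "s = t \<and> concat (map enc_term ss) @ 11 # r = concat (map enc_term ts') @ 11 # r'"
    by (rule enc_term_cancel)
  then have "ss = ts' \<and> r = r'" by (intro Cons.IH) simp
  with 1 ts show ?case by simp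
qed

lemma enc_so_cancel: "enc_so \<phi> @ r = enc_so \<psi> @ r' \<Longrightarrow> \<phi> = \<psi> \<and> r = r'"
proof (induction \<phi> arbitrary: \<psi> r r')
  case (SEq s t) then show ?case by (cases \<psi>) (auto dest!: enc_term_cancel)
next
  case (SLe s t) then show ?case by (cases \<psi>) (auto dest!: enc_term_cancel)
next
  case (SApp X ts) then show ?case by (cases \<psi>) (auto dest!: bin_delim_cancel enc_terms_cancel)
next
  case (SNot \<phi>)
  from SNot.prems obtain \<psi>' where "\<psi> = SNot \<psi>'" "enc_so \<phi> @ r = enc_so \<psi>' @ r'" by (cases \<psi>) auto
  with SNot.IH show ?case by blast
next
  case (SAnd \<phi>1 \<phi>2)
  from SAnd.prems obtain \<psi>1 \<psi>2 where \<psi>: "\<psi> = SAnd \<psi>1 \<psi>2" by (cases \<psi>) auto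
  with SAnd.prems have "enc_so \<phi>1 @ enc_so \<phi>2 @ r = enc_so \<psi>1 @ enc_so \<psi>2 @ r'" by simp
  then have 1: "\<phi>1 = \<psi>1 \<and> enc_so \<phi>2 @ r = enc_so \<psi>2 @ r'" by (rule SAnd.IH(1))
  then have "\<phi>2 = \<psi>2 \<and> r = r'" by (intro SAnd.IH(2)) simp
  with 1 \<psi> show ?case by simp
next
  case (SOr \<phi>1 \<phi>2)
  from SOr.prems obtain \<psi>1 \<psi>2 where \<psi>: "\<psi> = SOr \<psi>1 \<psi>2" by (cases \<psi>) auto
  with SOr.prems have "enc_so \<phi>1 @ enc_so \<phi>2 @ r = enc_so \<psi>1 @ enc_so \<psi>2 @ r'" by simp
  then have 1: "\<phi>1 = \<psi>1 \<and> enc_so \<phi>2 @ r = enc_so \<psi>2 @ r'" by (rule SOr.IH(1))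
  then have "\<phi>2 = \<psi>2 \<and> r = r'" by (intro SOr.IH(2)) simp
  with 1 \<psi> show ?case by simp
next
  case (SEx1 x \<phi>)
  from SEx1.prems obtain \<psi>' where "\<psi> = SEx1 x \<psi>'" "enc_so \<phi> @ r = enc_so \<psi>' @ r'"
    by (cases \<psi>) (auto dest!: bin_delim_cancel)
  with SEx1.IH show ?case by blast
next
  case (SAll1 x \<phi>)
  from SAll1.prems obtain \<psi>' where "\<psi> = SAll1 x \<psi>'" "enc_so \<phi> @ r = enc_so \<psi>' @ r'"
    by (cases \<psi>) (auto dest!: bin_delim_cancel)
  with SAll1.IH show ?case by blast
next
  case (SEx2 X n \<phi>)
  from SEx2.prems obtain \<psi>' where "\<psi> = SEx2 X n \<psi>'" "enc_so \<phi> @ r = enc_so \<psi>' @ r'"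
    by (cases \<psi>) (auto dest!: bin_delim_cancel)
  with SEx2.IH show ?case by blast
next
  case (SAll2 X n \<phi>)
  from SAll2.prems obtain \<psi>' where "\<psi> = SAll2 X n \<psi>'" "enc_so \<phi> @ r = enc_so \<psi>' @ r'"
    by (cases \<psi>) (auto dest!: bin_delim_cancel)
  with SAll2.IH show ?case by blast
qed

text \<open>Rules out both empty output and the error symbol 0 wherever a formula is
  expected.\<close>

lemma enc_so_Cons: "\<exists>a z. enc_so \<phi> = a # z \<and> a \<ge> 8"
  by (cases \<phi>) auto

text \<open>A frame is a formula with a hole at its very end, so that its code is a prefix of the code of
  the filled formula.\<close>

datatype frame =
    FNot
  | FAnd soform
  | FOr soform
  | FEx1 nat
  | FAll1 nat
  | FEx2 nat nat
  | FAll2 nat nat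

primrec plug :: "frame \<Rightarrow> soform \<Rightarrow> soform" where
  "plug FNot \<chi> = SNot \<chi>"
| "plug (FAnd \<phi>) \<chi> = SAnd \<phi> \<chi>"
| "plug (FOr \<phi>) \<chi> = SOr \<phi> \<chi>"
| "plug (FEx1 x) \<chi> = SEx1 x \<chi>"
| "plug (FAll1 x) \<chi> = SAll1 x \<chi>"
| "plug (FEx2 X n) \<chi> = SEx2 X n \<chi>"
| "plug (FAll2 X n) \<chi> = SAll2 X n \<chi>"

primrec enc_frame :: "frame \<Rightarrow> nat list" where
  "enc_frame FNot = [12]"
| "enc_frame (FAnd \<phi>) = 13 # enc_so \<phi>"
| "enc_frame (FOr \<phi>) = 14 # enc_so \<phi>"
| "enc_frame (FEx1 x) = 15 # bin x @ [3]"
| "enc_frame (FAll1 x) = 16 # bin x @ [3]"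
| "enc_frame (FEx2 X n) = 17 # bin X @ [3] @ bin n @ [3]"
| "enc_frame (FAll2 X n) = 18 # bin X @ [3] @ bin n @ [3]"

primrec plugs :: "frame list \<Rightarrow> soform \<Rightarrow> soform" where
  "plugs [] \<chi> = \<chi>"
| "plugs (f # fs) \<chi> = plug f (plugs fs \<chi>)"

abbreviation enc_frames :: "frame list \<Rightarrow> nat list" where
  "enc_frames fs \<equiv> concat (map enc_frame fs)"

lemma plugs_append [simp]: "plugs (fs @ gs) \<chi> = plugs fs (plugs gs \<chi>)"
  by (induction fs) auto

lemma enc_plug: "enc_so (plug f \<chi>) = enc_frame f @ enc_so \<chi>"
  by (cases f) auto

lemma enc_plugs: "enc_so (plugs fs \<chi>) = enc_frames fs @ enc_so \<chi>"
  by (induction fs) (auto simp: enc_plug)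

text \<open>The first symbol determines the constructor, and the rest of a frame is built from
  prefix-free codes, so it cancels.\<close>

lemma enc_frame_decode:
  assumes "enc_frame f @ z = enc_so \<chi> @ r"
  shows "\<exists>\<chi>'. \<chi> = plug f \<chi>' \<and> z = enc_so \<chi>' @ r"
  using assms
  by (cases f; cases \<chi>) (auto dest!: bin_delim_cancel enc_so_cancel)

lemma enc_frames_decode:
  assumes "enc_frames fs @ z = enc_so \<chi> @ r"
  shows "\<exists>\<chi>'. \<chi> = plugs fs \<chi>' \<and> z = enc_so \<chi>' @ r"
  using assms
proof (induction fs arbitrary: \<chi>)
  case (Cons f fs)
  then obtain \<chi>1 where "\<chi> = plug f \<chi>1" "enc_frames fs @ z = enc_so \<chi>1 @ r"
    using enc_frame_decode[of f "enc_frames fs @ z" \<chi> r] by auto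
  with Cons.IH show ?case by auto
qed simp

subsection \<open>The translation\<close>

definition SImp :: "soform \<Rightarrow> soform \<Rightarrow> soform" where "SImp \<phi> \<psi> = SOr (SNot \<phi>) \<psi>"
definition SIff :: "soform \<Rightarrow> soform \<Rightarrow> soform" where
  "SIff \<phi> \<psi> = SAnd (SImp \<phi> \<psi>) (SImp \<psi> \<phi>)"

lemma SImp_simps [simp]:
  "asat \<sigma> \<rho> (SImp \<phi> \<psi>) = (asat \<sigma> \<rho> \<phi> \<longrightarrow> asat \<sigma> \<rho> \<psi>)"
  "fv1 (SImp \<phi> \<psi>) = fv1 \<phi> \<union> fv1 \<psi>"
  "fv2 (SImp \<phi> \<psi>) = fv2 \<phi> \<union> fv2 \<psi>"
  "pos_arities (SImp \<phi> \<psi>) = (pos_arities \<phi> \<and> pos_arities \<psi>)"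
  by (auto simp: SImp_def)

lemma SIff_simps [simp]:
  "asat \<sigma> \<rho> (SIff \<phi> \<psi>) = (asat \<sigma> \<rho> \<phi> = asat \<sigma> \<rho> \<psi>)"
  "fv1 (SIff \<phi> \<psi>) = fv1 \<phi> \<union> fv1 \<psi>"
  "fv2 (SIff \<phi> \<psi>) = fv2 \<phi> \<union> fv2 \<psi>"
  "pos_arities (SIff \<phi> \<psi>) = (pos_arities \<phi> \<and> pos_arities \<psi>)"
  by (auto simp: SIff_def)

abbreviation fimp :: "soform \<Rightarrow> frame" where "fimp \<phi> \<equiv> FOr (SNot \<phi>)"
abbreviation v :: "nat \<Rightarrow> aterm" where "v \<equiv> AVar"

text \<open>Variables: the ternary \<open>(0, 3)\<close> lists the traces (\<open>p\<close> holds in the \<open>i\<close>-th trace at time \<open>n\<close>), the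
  unary \<open>(0, 1)\<close> holds the indices of the current team, and \<open>v 0\<close> is the current time. Everything else is
  scratch. Two indices may denote equal suffixes; this is harmless since a disjunction may split a team
  into overlapping parts. A formula \<open>SAnd (plugs fs \<chi>\<^sub>1) \<chi>\<^sub>2\<close> lets the two arguments be
  evaluated in different environments although their codes are adjacent.\<close>

definition bit_frames :: "nat \<Rightarrow> frame list" where
  "bit_frames b = [FEx1 5, FAnd (SEq (v 5) (APlus (APlus (v 4) (v 4)) (if b = 0 then AZero else AOne))),
  FEx1 4, FAnd (SEq (v 4) (v 5))]"
definition "atom_frames = [FEx1 4, FAnd (SEq (v 4) AZero)]"
definition "atom_end = SAll1 3 (SImp (SApp 0 [v 3]) (SApp 0 [v 3, v 0, v 4]))"
text \<open>Exactly one set has \<open>v 3\<close> as its only element, so a guarded universal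
  quantifier serves to rebind the team to that singleton.\<close>

definition "neg_frames = [FAll1 3, fimp (SApp 0 [v 3]), FAll2 0 1,
  fimp (SAll1 4 (SIff (SApp 0 [v 4]) (SEq (v 4) (v 3)))), FNot]"
text \<open>\<open>(2, 1)\<close> saves the old team, since the covering condition is checked only
  after \<open>(0, 1)\<close> has become the right part. \<open>(1, 1)\<close> keeps the left part
  until \<open>or_left_frames\<close> makes it the current team.\<close>

definition "or_frames = [FEx2 1 1, FEx2 2 1, FAnd (SAll1 4 (SIff (SApp 2 [v 4]) (SApp 0 [v 4]))), FEx2 0 1,
  FAnd (SAll1 4 (SIff (SApp 2 [v 4]) (SOr (SApp 1 [v 4]) (SApp 0 [v 4]))))]"
definition "or_left_frames = [FEx2 0 1, FAnd (SAll1 4 (SIff (SApp 0 [v 4]) (SApp 1 [v 4])))]"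
text \<open>The new time passes through scratch variable 1, as binding \<open>v 0\<close> directly
  would hide the old time.\<close>

definition "X_frames = [FEx1 1, FAnd (SEq (v 1) (APlus (v 0) AOne)), FEx1 0, FAnd (SEq (v 0) (v 1))]"
definition "F_frames = [FEx1 1, FAnd (SLe (v 0) (v 1)), FEx1 0, FAnd (SEq (v 0) (v 1))]"
definition "G_frames = [FAll1 1, fimp (SLe (v 0) (v 1)), FEx1 0, FAnd (SEq (v 0) (v 1))]"
text \<open>\<open>v 1\<close> is the time at which the whole formula is evaluated,
  \<open>v 2\<close> the time chosen for the right operand.\<close>

definition "before = SAnd (SLe (v 1) (v 0)) (SLe (APlus (v 0) AOne) (v 2))"
definition "U_frames = [FEx1 1, FAnd (SEq (v 1) (v 0)), FEx1 0, FAnd (SLe (v 1) (v 0))]"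
definition "U_left_frames = [FEx1 2, FAnd (SEq (v 2) (v 0)), FAll1 0, fimp before]"
definition "R_frames = [FEx1 1, FAnd (SEq (v 1) (v 0)), FAll1 0, fimp (SLe (v 1) (v 0))]"
definition "R_left_frames = [FEx1 2, FAnd (SEq (v 2) (v 0)), FEx1 0, FAnd before]"

lemmas block_defs = bit_frames_def atom_frames_def atom_end_def neg_frames_def or_frames_def
  or_left_frames_def X_frames_def F_frames_def G_frames_def before_def U_frames_def
  U_left_frames_def R_frames_def R_left_frames_def

primrec so_of_ltl :: "ltl \<Rightarrow> soform" where
  "so_of_ltl (LAtom p) = plugs (atom_frames @ concat (map bit_frames (bin p))) atom_end"
| "so_of_ltl (LNeg \<phi>) = plugs neg_frames (so_of_ltl \<phi>)"
| "so_of_ltl (LAnd \<phi> \<psi>) = SAnd (so_of_ltl \<phi>) (so_of_ltl \<psi>)"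
| "so_of_ltl (LOr \<phi> \<psi>) = plugs or_frames (SAnd (plugs or_left_frames (so_of_ltl \<phi>)) (so_of_ltl \<psi>))"
| "so_of_ltl (LX \<phi>) = plugs X_frames (so_of_ltl \<phi>)"
| "so_of_ltl (LF \<phi>) = plugs F_frames (so_of_ltl \<phi>)"
| "so_of_ltl (LG \<phi>) = plugs G_frames (so_of_ltl \<phi>)"
| "so_of_ltl (LU \<phi> \<psi>) = plugs U_frames (SAnd (plugs U_left_frames (so_of_ltl \<phi>)) (so_of_ltl \<psi>))"
| "so_of_ltl (LR \<phi> \<psi>) = plugs R_frames (SOr (plugs R_left_frames (so_of_ltl \<phi>)) (so_of_ltl \<psi>))"
| "so_of_ltl (LTilde \<phi>) = plugs [FNot] (so_of_ltl \<phi>)"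

text \<open>Modes of the transducer: 0 expects a formula, 1 and 2 are inside the code of an atom, with 1
  before the first bit. Ill-formed input is translated to the symbol 0, which starts no formula.\<close>

definition token_block :: "nat \<Rightarrow> nat list" where
  "token_block a =
    (if a = 2 then enc_frames atom_frames
     else if a = 4 then enc_frames neg_frames
     else if a = 5 then [13]
     else if a = 6 then enc_frames or_frames @ 13 # enc_frames or_left_frames
     else if a = 7 then enc_frames X_frames
     else if a = 8 then enc_frames F_frames
     else if a = 9 then enc_frames G_frames
     else if a = 10 then enc_frames U_frames @ 13 # enc_frames U_left_frames
     else if a = 11 then enc_frames R_frames @ 14 # enc_frames R_left_frames
     else if a = 12 then enc_frames [FNot]
     else [0])"

definition tr_next :: "nat \<Rightarrow> nat \<Rightarrow> nat" where
  "tr_next m a = (if m = 0 then (if a = 2 then 1 else 0) else if a = 3 then 0 else 2)"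

definition tr_out :: "nat \<Rightarrow> nat \<Rightarrow> nat list" where
  "tr_out m a =
    (if m = 0 then token_block a
     else if a = 3 then enc_so atom_end
     else if a = 1 \<or> a = 0 \<and> m = 2 then enc_frames (bit_frames a)
     else [0])"

definition tr :: "nat list \<Rightarrow> nat \<Rightarrow> nat list" where
  "tr = fst_run tr_next tr_out"

lemma tr_Nil [simp]: "tr [] m = []"
  by (simp add: tr_def)

lemma tr_Cons: "tr (a # w) m = tr_out m a @ tr w (tr_next m a)"
  by (simp add: tr_def del: One_nat_def)

lemma tr_Cons_0: "tr (a # w) 0 = token_block a @ tr w (if a = 2 then 1 else 0)"
  by (simp add: tr_Cons tr_out_def tr_next_def)

lemma tr_Cons_number:
  "m \<noteq> 0 \<Longrightarrow> tr (a # w) m =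
    (if a = 3 then enc_so atom_end @ tr w 0
     else if a = 1 \<or> a = 0 \<and> m = 2 then enc_frames (bit_frames a) @ tr w 2
     else 0 # tr w 2)"
  by (simp add: tr_Cons tr_out_def tr_next_def)

lemma tr_bits:
  assumes "set bs \<subseteq> {0, 1}" "m = 2 \<or> m = 1 \<and> (bs = [] \<or> hd bs = 1)"
  shows "tr (bs @ 3 # w) m = enc_so (plugs (concat (map bit_frames bs)) atom_end) @ tr w 0"
  using assms
  by (induction bs arbitrary: m) (auto simp: tr_Cons_number enc_plugs)

lemma tr_enc_ltl: "tr (enc_ltl \<phi> @ w) 0 = enc_so (so_of_ltl \<phi>) @ tr w 0"
proof (induction \<phi> arbitrary: w)
  case (LAtom p)
  show ?case
    using tr_bits[OF bin_bits, of 1 p w] bin_canonical[of p]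
    by (simp add: tr_Cons_0 token_block_def enc_plugs)
qed (simp_all add: tr_Cons_0 token_block_def enc_plugs)

section \<open>Recovering the input from well-formed output\<close>

lemma tr_bits_decode:
  assumes "tr w m = enc_so \<chi> @ r" "m = 1 \<or> m = 2"
  shows "\<exists>bs w'. w = bs @ 3 # w' \<and> set bs \<subseteq> {0, 1} \<and> (m = 1 \<longrightarrow> bs = [] \<or> hd bs = 1) \<and>
    \<chi> = plugs (concat (map bit_frames bs)) atom_end \<and> r = tr w' 0"
  using assms
proof (induction w arbitrary: m \<chi>)
  case Nil
  then show ?case using enc_so_Cons[of \<chi>] by auto
next
  case (Cons a w)
  consider "a = 3" | "a = 1 \<or> a = 0 \<and> m = 2" | "\<not> (a = 3 \<or> a = 1 \<or> a = 0 \<and> m = 2)" by blast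
  then show ?case
  proof cases
    case 1
    then have "enc_so atom_end @ tr w 0 = enc_so \<chi> @ r"
      using Cons.prems by (auto simp: tr_Cons_number)
    then have "atom_end = \<chi> \<and> tr w 0 = r" by (rule enc_so_cancel)
    then show ?thesis using 1 by (intro exI[of _ "[]"] exI[of _ w]) simp
  next
    case 2
    then have "enc_frames (bit_frames a) @ tr w 2 = enc_so \<chi> @ r"
      using Cons.prems by (auto simp: tr_Cons_number)
    then obtain \<chi>' where \<chi>: "\<chi> = plugs (bit_frames a) \<chi>'" "tr w 2 = enc_so \<chi>' @ r"
      using enc_frames_decode by blast
    from Cons.IH[OF this(2)] obtain bs w' where
      "w = bs @ 3 # w'" "set bs \<subseteq> {0, 1}" "\<chi>' = plugs (concat (map bit_frames bs)) atom_end" "r = tr w' 0"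
      by auto
    then show ?thesis using 2 \<chi> Cons.prems(2)
      by (intro exI[of _ "a # bs"] exI[of _ w']) auto
  next
    case 3
    then have "enc_so \<chi> @ r = 0 # tr w 2"
      using Cons.prems by (auto simp: tr_Cons_number)
    then show ?thesis using enc_so_Cons[of \<chi>] by auto
  qed
qed

text \<open>The block of the first letter fixes the top of \<open>\<chi>\<close> or is the error
  symbol. The tail \<open>r\<close> is general because what follows one operand is again output, on
  a shorter suffix; a second operand may start at any suffix, hence induction on length.\<close>

lemma tr_decode:
  assumes "tr w 0 = enc_so \<chi> @ r"
  shows "\<exists>\<phi> w'. w = enc_ltl \<phi> @ w' \<and> \<chi> = so_of_ltl \<phi> \<and> r = tr w' 0"
  using assms
proof (induction w arbitrary: \<chi> r rule: length_induct)
  case (1 w)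
  show ?case
  proof (cases w)
    case Nil
    then show ?thesis using "1.prems" enc_so_Cons[of \<chi>] by auto
  next
    case w: (Cons a w1)
    have IH: "\<exists>\<phi> w''. w' = enc_ltl \<phi> @ w'' \<and> \<chi>' = so_of_ltl \<phi> \<and> r' = tr w'' 0"
      if "length w' \<le> length w1" "tr w' 0 = enc_so \<chi>' @ r'" for w' \<chi>' r'
      using "1.IH"[rule_format, of w' \<chi>' r'] that w by simp
    have IH2: "\<exists>\<phi> \<psi> w'. w1 = enc_ltl \<phi> @ enc_ltl \<psi> @ w' \<and> \<chi>1 = so_of_ltl \<phi> \<and> \<chi>2 = so_of_ltl \<psi> \<and> r = tr w' 0"
      if z: "tr w1 0 = enc_so \<chi>1 @ enc_so \<chi>2 @ r" for \<chi>1 \<chi>2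
    proof -
      obtain \<phi> w' where 1: "w1 = enc_ltl \<phi> @ w'" "\<chi>1 = so_of_ltl \<phi>" "enc_so \<chi>2 @ r = tr w' 0"
        using IH[OF order_refl z] by blast
      then have "length w' \<le> length w1" "tr w' 0 = enc_so \<chi>2 @ r" by simp_all
      from IH[OF this] 1 show ?thesis by blast
    qed
    have unary: "\<exists>\<phi> w'. w1 = enc_ltl \<phi> @ w' \<and> \<chi> = plugs fs (so_of_ltl \<phi>) \<and> r = tr w' 0"
      if "tr w 0 = enc_frames fs @ tr w1 0" for fs
    proof -
      have "enc_frames fs @ tr w1 0 = enc_so \<chi> @ r"
        using "1.prems" that by simp
      from enc_frames_decode[OF this] obtain \<chi>' where "\<chi> = plugs fs \<chi>'" "tr w1 0 = enc_so \<chi>' @ r"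
        by blast
      with IH[OF order_refl] show ?thesis by blast
    qed
    have conj: "\<exists>\<phi> \<psi> w'. w1 = enc_ltl \<phi> @ enc_ltl \<psi> @ w' \<and>
        \<chi> = plugs fs (SAnd (plugs gs (so_of_ltl \<phi>)) (so_of_ltl \<psi>)) \<and> r = tr w' 0"
      if "tr w 0 = enc_frames fs @ 13 # enc_frames gs @ tr w1 0" for fs gs
    proof -
      have "enc_frames fs @ 13 # enc_frames gs @ tr w1 0 = enc_so \<chi> @ r"
        using "1.prems" that by simp
      from enc_frames_decode[OF this] obtain \<chi>' where \<chi>': "\<chi> = plugs fs \<chi>'" "13 # enc_frames gs @ tr w1 0 = enc_so \<chi>' @ r"
        by blast
      then obtain \<chi>1 \<chi>2 where \<chi>12: "\<chi>' = SAnd \<chi>1 \<chi>2" "enc_frames gs @ tr w1 0 = enc_so \<chi>1 @ enc_so \<chi>2 @ r"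
        by (cases \<chi>') auto
      then obtain \<chi>3 where "\<chi>1 = plugs gs \<chi>3" "tr w1 0 = enc_so \<chi>3 @ enc_so \<chi>2 @ r"
        using enc_frames_decode by blast
      then show ?thesis using IH2 \<chi>' \<chi>12 by blast
    qed
    have disj: "\<exists>\<phi> \<psi> w'. w1 = enc_ltl \<phi> @ enc_ltl \<psi> @ w' \<and>
        \<chi> = plugs fs (SOr (plugs gs (so_of_ltl \<phi>)) (so_of_ltl \<psi>)) \<and> r = tr w' 0"
      if "tr w 0 = enc_frames fs @ 14 # enc_frames gs @ tr w1 0" for fs gs
    proof -
      have "enc_frames fs @ 14 # enc_frames gs @ tr w1 0 = enc_so \<chi> @ r"
        using "1.prems" that by simp
      from enc_frames_decode[OF this] obtain \<chi>' where \<chi>': "\<chi> = plugs fs \<chi>'" "14 # enc_frames gs @ tr w1 0 = enc_so \<chi>' @ r"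
        by blast
      then obtain \<chi>1 \<chi>2 where \<chi>12: "\<chi>' = SOr \<chi>1 \<chi>2" "enc_frames gs @ tr w1 0 = enc_so \<chi>1 @ enc_so \<chi>2 @ r"
        by (cases \<chi>') auto
      then obtain \<chi>3 where "\<chi>1 = plugs gs \<chi>3" "tr w1 0 = enc_so \<chi>3 @ enc_so \<chi>2 @ r"
        using enc_frames_decode by blast
      then show ?thesis using IH2 \<chi>' \<chi>12 by blast
    qed
    have tr_w: "tr w 0 = token_block a @ tr w1 (if a = 2 then 1 else 0)"
      by (simp add: w tr_Cons_0)
    consider "a = 2" | "a = 4" | "a = 5" | "a = 6" | "a = 7" | "a = 8" | "a = 9" | "a = 10" | "a = 11"
      | "a = 12" | "a \<notin> {2, 4, 5, 6, 7, 8, 9, 10, 11, 12}" by blast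
    then show ?thesis
    proof cases
      case 1
      then have "enc_frames atom_frames @ tr w1 1 = enc_so \<chi> @ r"
        using tr_w "1.prems" by (simp add: token_block_def)
      then obtain \<chi>' where \<chi>: "\<chi> = plugs atom_frames \<chi>'" "tr w1 1 = enc_so \<chi>' @ r"
        using enc_frames_decode by blast
      from tr_bits_decode[OF this(2)] obtain bs w' where bs: "w1 = bs @ 3 # w'" "set bs \<subseteq> {0, 1}"
        "bs = [] \<or> hd bs = 1" "\<chi>' = plugs (concat (map bit_frames bs)) atom_end" "r = tr w' 0"
        by auto
      \<comment> \<open>Without a leading zero, the bits are the code of their Horner value.\<close>
      then show ?thesis using \<chi> w 1
        by (intro exI[of _ "LAtom (horner 0 bs)"] exI[of _ w']) (simp add: bin_horner)
    next
      case 2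
      then have "tr w 0 = enc_frames neg_frames @ tr w1 0"
        using tr_w by (simp add: token_block_def)
      then obtain \<phi> w' where "w1 = enc_ltl \<phi> @ w'" "\<chi> = plugs neg_frames (so_of_ltl \<phi>)" "r = tr w' 0"
        using unary by blast
      then show ?thesis using w 2 by (intro exI[of _ "LNeg \<phi>"] exI[of _ w']) simp
    next
      case 3
      then have "tr w 0 = enc_frames [] @ 13 # enc_frames [] @ tr w1 0"
        using tr_w by (simp add: token_block_def)
      then obtain \<phi> \<psi> w' where "w1 = enc_ltl \<phi> @ enc_ltl \<psi> @ w'"
          "\<chi> = SAnd (so_of_ltl \<phi>) (so_of_ltl \<psi>)" "r = tr w' 0"
        using conj[of "[]" "[]"] by auto
      then show ?thesis using w 3 by (intro exI[of _ "LAnd \<phi> \<psi>"] exI[of _ w']) simp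
    next
      case 4
      then have "tr w 0 = enc_frames or_frames @ 13 # enc_frames or_left_frames @ tr w1 0"
        using tr_w by (simp add: token_block_def)
      then obtain \<phi> \<psi> w' where "w1 = enc_ltl \<phi> @ enc_ltl \<psi> @ w'"
          "\<chi> = plugs or_frames (SAnd (plugs or_left_frames (so_of_ltl \<phi>)) (so_of_ltl \<psi>))" "r = tr w' 0"
        using conj by blast
      then show ?thesis using w 4 by (intro exI[of _ "LOr \<phi> \<psi>"] exI[of _ w']) simp
    next
      case 5
      then have "tr w 0 = enc_frames X_frames @ tr w1 0"
        using tr_w by (simp add: token_block_def)
      then obtain \<phi> w' where "w1 = enc_ltl \<phi> @ w'" "\<chi> = plugs X_frames (so_of_ltl \<phi>)" "r = tr w' 0"
        using unary by blast
      then show ?thesis using w 5 by (intro exI[of _ "LX \<phi>"] exI[of _ w']) simp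
    next
      case 6
      then have "tr w 0 = enc_frames F_frames @ tr w1 0"
        using tr_w by (simp add: token_block_def)
      then obtain \<phi> w' where "w1 = enc_ltl \<phi> @ w'" "\<chi> = plugs F_frames (so_of_ltl \<phi>)" "r = tr w' 0"
        using unary by blast
      then show ?thesis using w 6 by (intro exI[of _ "LF \<phi>"] exI[of _ w']) simp
    next
      case 7
      then have "tr w 0 = enc_frames G_frames @ tr w1 0"
        using tr_w by (simp add: token_block_def)
      then obtain \<phi> w' where "w1 = enc_ltl \<phi> @ w'" "\<chi> = plugs G_frames (so_of_ltl \<phi>)" "r = tr w' 0"
        using unary by blast
      then show ?thesis using w 7 by (intro exI[of _ "LG \<phi>"] exI[of _ w']) simp
    next
      case 8
      then have "tr w 0 = enc_frames U_frames @ 13 # enc_frames U_left_frames @ tr w1 0"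
        using tr_w by (simp add: token_block_def)
      then obtain \<phi> \<psi> w' where "w1 = enc_ltl \<phi> @ enc_ltl \<psi> @ w'"
          "\<chi> = plugs U_frames (SAnd (plugs U_left_frames (so_of_ltl \<phi>)) (so_of_ltl \<psi>))" "r = tr w' 0"
        using conj by blast
      then show ?thesis using w 8 by (intro exI[of _ "LU \<phi> \<psi>"] exI[of _ w']) simp
    next
      case 9
      then have "tr w 0 = enc_frames R_frames @ 14 # enc_frames R_left_frames @ tr w1 0"
        using tr_w by (simp add: token_block_def)
      then obtain \<phi> \<psi> w' where "w1 = enc_ltl \<phi> @ enc_ltl \<psi> @ w'"
          "\<chi> = plugs R_frames (SOr (plugs R_left_frames (so_of_ltl \<phi>)) (so_of_ltl \<psi>))" "r = tr w' 0"
        using disj by blast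
      then show ?thesis using w 9 by (intro exI[of _ "LR \<phi> \<psi>"] exI[of _ w']) simp
    next
      case 10
      then have "tr w 0 = enc_frames [FNot] @ tr w1 0"
        using tr_w by (simp add: token_block_def)
      then obtain \<phi> w' where "w1 = enc_ltl \<phi> @ w'" "\<chi> = plugs [FNot] (so_of_ltl \<phi>)" "r = tr w' 0"
        using unary by blast
      then show ?thesis using w 10 by (intro exI[of _ "LTilde \<phi>"] exI[of _ w']) simp
    next
      case 11
      then have "enc_so \<chi> @ r = 0 # tr w1 0"
        using tr_w "1.prems" by (simp add: token_block_def)
      then show ?thesis using enc_so_Cons[of \<chi>] by auto
    qed
  qed
qed

text \<open>Empty output forces empty input, so nothing can follow a complete formula
  unnoticed.\<close>

lemma tr_out_nonempty: "tr_out m a \<noteq> []"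
  using enc_so_Cons[of atom_end] by (auto simp: tr_out_def token_block_def block_defs)

lemma tr_encodes_iff:
  "enc_frames fs @ tr w 0 = enc_so \<chi> \<longleftrightarrow> (\<exists>\<phi>. w = enc_ltl \<phi> \<and> \<chi> = plugs fs (so_of_ltl \<phi>))"
proof
  assume "enc_frames fs @ tr w 0 = enc_so \<chi>"
  then obtain \<chi>' where \<chi>: "\<chi> = plugs fs \<chi>'" "tr w 0 = enc_so \<chi>' @ []"
    using enc_frames_decode[of fs "tr w 0" \<chi> "[]"] by auto
  from tr_decode[OF this(2)] obtain \<phi> w' where "w = enc_ltl \<phi> @ w'" "\<chi>' = so_of_ltl \<phi>" "tr w' 0 = []"
    by auto
  moreover from this have "w' = []" by (cases w') (simp_all add: tr_Cons tr_out_nonempty)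
  ultimately show "\<exists>\<phi>. w = enc_ltl \<phi> \<and> \<chi> = plugs fs (so_of_ltl \<phi>)" using \<chi> by auto
next
  assume "\<exists>\<phi>. w = enc_ltl \<phi> \<and> \<chi> = plugs fs (so_of_ltl \<phi>)"
  then show "enc_frames fs @ tr w 0 = enc_so \<chi>"
    using tr_enc_ltl[of _ "[]"] by (auto simp: enc_plugs)
qed

lemma tr_logspace: "logspace_computable (\<lambda>w. b0 @ tr w 0)"
proof -
  \<comment> \<open>Letters are arbitrary numbers, but all above 12 give the error block, so only
    finitely many blocks occur.\<close>
  define B where "B = {b0, enc_so atom_end, enc_frames (bit_frames 1), enc_frames (bit_frames 0)} \<union>
    token_block ` {..12} \<union> {[0]}"
  have "finite B" by (simp add: B_def)
  moreover have "tr_out m a \<in> B" for m a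
  proof (cases "a \<le> 12")
    case True
    then have "token_block a \<in> B" by (simp add: B_def)
    then show ?thesis by (auto simp: B_def tr_out_def)
  next
    case False
    then show ?thesis by (simp add: B_def tr_out_def token_block_def)
  qed
  moreover have "b0 \<in> B" by (simp add: B_def)
  ultimately have len: "length b0 \<le> Max (length ` B)" "length (tr_out m a) \<le> Max (length ` B)" for m a
    by (simp_all add: Max_ge)
  interpret finite_transducer 3 "Max (length ` B)" b0 tr_next tr_out
    by standard (use len in \<open>auto simp: tr_next_def\<close>)
  show ?thesis unfolding tr_def by (rule logspace)
qed

subsection \<open>Correctness of the translation\<close>

text \<open>The \<open>rel\<close> maps and their inverses \<open>un\<close> let second-order
  quantifiers of arity 1, 2 and 3 range over index sets, traces and sequences of traces.\<close>

definition rel1 :: "nat set \<Rightarrow> nat list set" where "rel1 I = {[i] |i. i \<in> I}"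
definition rel2 :: "trace \<Rightarrow> nat list set" where "rel2 t = {[n, p] |n p. p \<in> t n}"
definition rel3 :: "(nat \<Rightarrow> trace) \<Rightarrow> nat list set" where "rel3 A = {[i, n, p] |i n p. p \<in> A i n}"
definition un1 :: "nat list set \<Rightarrow> nat set" where "un1 S = {i. [i] \<in> S}"
definition un2 :: "nat list set \<Rightarrow> trace" where "un2 S n = {p. [n, p] \<in> S}"
definition un3 :: "nat list set \<Rightarrow> nat \<Rightarrow> trace" where "un3 S i n = {p. [i, n, p] \<in> S}"

lemma un_rel [simp]: "un1 (rel1 I) = I" "un2 (rel2 t) = t" "un3 (rel3 A) = A"
  by (auto simp: un1_def rel1_def un2_def rel2_def un3_def rel3_def fun_eq_iff)

lemma mem_rel [simp]:
  "[i] \<in> rel1 I \<longleftrightarrow> i \<in> I" "[n, p] \<in> rel2 t \<longleftrightarrow> p \<in> t n" "[i, n, p] \<in> rel3 A \<longleftrightarrow> p \<in> A i n"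
  by (auto simp: rel1_def rel2_def rel3_def)

lemma rel_un:
  "S \<subseteq> {xs. length xs = 1} \<Longrightarrow> rel1 (un1 S) = S"
  "S \<subseteq> {xs. length xs = 2} \<Longrightarrow> rel2 (un2 S) = S"
  "S \<subseteq> {xs. length xs = 3} \<Longrightarrow> rel3 (un3 S) = S"
  by (fastforce simp: un1_def rel1_def un2_def rel2_def un3_def rel3_def numeral_eq_Suc length_Suc_conv)+

lemma rel_length:
  "rel1 I \<subseteq> {xs. length xs = 1}" "rel2 t \<subseteq> {xs. length xs = 2}" "rel3 A \<subseteq> {xs. length xs = 3}"
  by (auto simp: rel1_def rel2_def rel3_def)

lemma ex_subset_via:
  assumes "\<And>t. r t \<subseteq> L" "\<And>S. S \<subseteq> L \<Longrightarrow> r (u S) = S"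
  shows "(\<exists>S. S \<subseteq> L \<and> P S) \<longleftrightarrow> (\<exists>t. P (r t))" and "(\<forall>S. S \<subseteq> L \<longrightarrow> P S) \<longleftrightarrow> (\<forall>t. P (r t))"
  using assms by metis+

lemma asat_second_order [simp]:
  "asat \<sigma> \<rho> (SEx2 X (Suc 0) \<phi>) \<longleftrightarrow> (\<exists>I. asat \<sigma> (\<rho>(X := (\<rho> X)(Suc 0 := rel1 I))) \<phi>)"
  "asat \<sigma> \<rho> (SAll2 X (Suc 0) \<phi>) \<longleftrightarrow> (\<forall>I. asat \<sigma> (\<rho>(X := (\<rho> X)(Suc 0 := rel1 I))) \<phi>)"
  "asat \<sigma> \<rho> (SEx2 X 2 \<phi>) \<longleftrightarrow> (\<exists>t. asat \<sigma> (\<rho>(X := (\<rho> X)(2 := rel2 t))) \<phi>)"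
  "asat \<sigma> \<rho> (SAll2 X 2 \<phi>) \<longleftrightarrow> (\<forall>t. asat \<sigma> (\<rho>(X := (\<rho> X)(2 := rel2 t))) \<phi>)"
  "asat \<sigma> \<rho> (SEx2 X 3 \<phi>) \<longleftrightarrow> (\<exists>A. asat \<sigma> (\<rho>(X := (\<rho> X)(3 := rel3 A))) \<phi>)"
  unfolding asat.simps One_nat_def[symmetric]
  by (rule ex_subset_via[where u = un1, OF rel_length(1) rel_un(1)] ex_subset_via[where u = un2, OF rel_length(2) rel_un(2)]
      ex_subset_via[where u = un3, OF rel_length(3) rel_un(3)]; assumption)+

lemma SApp_simps [simp]:
  "asat \<sigma> \<rho> (SApp X [a]) \<longleftrightarrow> [aeval \<sigma> a] \<in> \<rho> X (Suc 0)"
  "asat \<sigma> \<rho> (SApp X [a, b]) \<longleftrightarrow> [aeval \<sigma> a, aeval \<sigma> b] \<in> \<rho> X 2"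
  "asat \<sigma> \<rho> (SApp X [a, b, c]) \<longleftrightarrow> [aeval \<sigma> a, aeval \<sigma> b, aeval \<sigma> c] \<in> \<rho> X 3"
  "fv2 (SApp X [a]) = {(X, Suc 0)}"
  "fv2 (SApp X [a, b]) = {(X, 2)}"
  "fv2 (SApp X [a, b, c]) = {(X, 3)}"
  by (simp_all add: numeral_2_eq_2 numeral_3_eq_3)

declare asat.simps(3,9,10) [simp del] and fv2.simps(3) [simp del]

lemma team_suffix_image: "team_suffix k (f ` I) = (\<lambda>i. tsuffix k (f i)) ` I"
  by (auto simp: team_suffix_def)

text \<open>Suffixes change only the time \<open>n\<close> and splits only the index set
  \<open>I\<close>; the list \<open>A\<close> stays fixed throughout a formula.\<close>

definition team :: "(nat \<Rightarrow> trace) \<Rightarrow> nat set \<Rightarrow> nat \<Rightarrow> trace set" where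
  "team A I n = (\<lambda>i. tsuffix n (A i)) ` I"

lemma team_suffix_team [simp]: "team_suffix k (team A I n) = team A I (n + k)"
  by (simp add: team_def team_suffix_image tsuffix_def add.commute add.left_commute)

text \<open>Each part is lifted to all indices mapping into it. As parts may overlap,
  \<open>f\<close> may identify points; this serves both enumerations and label restriction, which
  can merge traces.\<close>

lemma image_split_ex:
  "(\<exists>S U. f ` I = S \<union> U \<and> P S \<and> Q U) \<longleftrightarrow> (\<exists>S U. I = S \<union> U \<and> P (f ` S) \<and> Q (f ` U))"
proof
  assume "\<exists>S U. f ` I = S \<union> U \<and> P S \<and> Q U"
  then obtain S U where SU: "f ` I = S \<union> U" "P S" "Q U" by blast
  have "f ` {i \<in> I. f i \<in> V} = f ` I \<inter> V" for V by auto
  then have eqs: "f ` {i \<in> I. f i \<in> S} = S" "f ` {i \<in> I. f i \<in> U} = U"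
    unfolding SU(1) by (simp_all add: Int_absorb1)
  have "f i \<in> S \<union> U" if "i \<in> I" for i
    using SU(1) that by (metis imageI)
  then have I: "I = {i \<in> I. f i \<in> S} \<union> {i \<in> I. f i \<in> U}"
    by auto
  show "\<exists>S U. I = S \<union> U \<and> P (f ` S) \<and> Q (f ` U)"
  proof (intro exI conjI)
    show "I = {i \<in> I. f i \<in> S} \<union> {i \<in> I. f i \<in> U}" by (rule I)
    show "P (f ` {i \<in> I. f i \<in> S})" "Q (f ` {i \<in> I. f i \<in> U})"
      unfolding eqs by (rule SU)+
  qed
next
  assume "\<exists>S U. I = S \<union> U \<and> P (f ` S) \<and> Q (f ` U)"
  then obtain S U where "I = S \<union> U" "P (f ` S)" "Q (f ` U)" by blast
  then show "\<exists>S U. f ` I = S \<union> U \<and> P S \<and> Q U"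
    by (intro exI[of _ "f ` S"] exI[of _ "f ` U"]) (simp add: image_Un)
qed

lemma until_shift:
  fixes n :: nat
  shows "(\<exists>k\<ge>n. (\<forall>j. n \<le> j \<and> j < k \<longrightarrow> P j) \<and> Q k) \<longleftrightarrow> (\<exists>k. (\<forall>j<k. P (n + j)) \<and> Q (n + k))"
proof
  assume "\<exists>k\<ge>n. (\<forall>j. n \<le> j \<and> j < k \<longrightarrow> P j) \<and> Q k"
  then obtain k where "k \<ge> n" "\<And>j. n \<le> j \<Longrightarrow> j < k \<Longrightarrow> P j" "Q k" by blast
  then show "\<exists>k. (\<forall>j<k. P (n + j)) \<and> Q (n + k)"
    by (intro exI[of _ "k - n"]) auto
next
  assume "\<exists>k. (\<forall>j<k. P (n + j)) \<and> Q (n + k)"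
  then obtain k where k: "\<And>j. j < k \<Longrightarrow> P (n + j)" "Q (n + k)" by blast
  have "P j" if "n \<le> j" "j < n + k" for j
    using k(1)[of "j - n"] that by simp
  with k(2) show "\<exists>k\<ge>n. (\<forall>j. n \<le> j \<and> j < k \<longrightarrow> P j) \<and> Q k"
    by (intro exI[of _ "n + k"]) auto
qed

lemma release_shift:
  fixes n :: nat
  shows "(\<forall>k\<ge>n. (\<exists>j. n \<le> j \<and> j < k \<and> P j) \<or> Q k) \<longleftrightarrow> (\<forall>k. (\<exists>j<k. P (n + j)) \<or> Q (n + k))"
  using until_shift[of n "\<lambda>x. \<not> P x" "\<lambda>x. \<not> Q x"] by blast

text \<open>Each bit is one Horner step on variable 4, with variable 5 carrying the new value across
  the rebinding.\<close>

lemma asat_bits: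
  "asat \<sigma> \<rho> (plugs (concat (map bit_frames bs)) atom_end) \<longleftrightarrow>
    (\<forall>i. [i] \<in> \<rho> 0 1 \<longrightarrow> [i, \<sigma> 0, horner (\<sigma> 4) bs] \<in> \<rho> 0 3)"
  if "set bs \<subseteq> {0, 1}"
  using that
proof (induction bs arbitrary: \<sigma>)
  case Nil
  then show ?case by (simp add: atom_end_def)
next
  case (Cons b bs)
  then show ?case by (auto simp: bit_frames_def mult_2)
qed

text \<open>Environments are arbitrary since every block rebinds variables. Only
  \<open>(0, 3)\<close>, \<open>(0, 1)\<close> and \<open>v 0\<close> enter the right-hand side, so
  scratch variables can be reused at every depth.\<close>

lemma asat_so_of_ltl:
  "asat \<sigma> \<rho> (so_of_ltl \<phi>) \<longleftrightarrow> tsat (team (un3 (\<rho> 0 3)) (un1 (\<rho> 0 1)) (\<sigma> 0)) \<phi>"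
proof (induction \<phi> arbitrary: \<sigma> \<rho>)
  case (LAtom p)
  show ?case
    by (simp add: atom_frames_def asat_bits[OF bin_bits] horner_bin team_def tsuffix_def un1_def un3_def)
next
  case (LNeg \<phi>)
  have "asat \<sigma> \<rho> (so_of_ltl (LNeg \<phi>)) \<longleftrightarrow>
    (\<forall>i. [i] \<in> \<rho> 0 1 \<longrightarrow> (\<forall>I. (\<forall>x. x \<in> I \<longleftrightarrow> x = i) \<longrightarrow> \<not> tsat (team (un3 (\<rho> 0 3)) I (\<sigma> 0)) \<phi>))"
    by (simp add: neg_frames_def LNeg del: not_all)
  moreover have "(\<forall>x. x \<in> I \<longleftrightarrow> x = i) \<longleftrightarrow> I = {i}" for I and i :: nat
    by auto
  ultimately show ?case by (simp add: team_def un1_def)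
next
  case (LAnd \<phi> \<psi>)
  then show ?case by simp
next
  case (LOr \<phi> \<psi>)
  let ?T = "\<lambda>I. team (un3 (\<rho> 0 3)) I (\<sigma> 0)"
  have "asat \<sigma> \<rho> (so_of_ltl (LOr \<phi> \<psi>)) \<longleftrightarrow>
    (\<exists>S O'. (\<forall>x. x \<in> O' \<longleftrightarrow> x \<in> un1 (\<rho> 0 1)) \<and> (\<exists>U. (\<forall>x. x \<in> O' \<longleftrightarrow> x \<in> S \<union> U) \<and>
       (\<exists>S'. (\<forall>x. x \<in> S' \<longleftrightarrow> x \<in> S) \<and> tsat (?T S') \<phi>) \<and> tsat (?T U) \<psi>))"
    by (simp add: or_frames_def or_left_frames_def LOr un1_def)
  also have "\<dots> \<longleftrightarrow> (\<exists>S U. un1 (\<rho> 0 1) = S \<union> U \<and> tsat (?T S) \<phi> \<and> tsat (?T U) \<psi>)"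
    unfolding set_eq_iff[symmetric] by blast
  finally show ?case by (simp add: team_def image_split_ex)
next
  case (LX \<phi>)
  then show ?case by (simp add: X_frames_def)
next
  case (LF \<phi>)
  let ?T = "\<lambda>n. team (un3 (\<rho> 0 3)) (un1 (\<rho> 0 1)) n"
  have "asat \<sigma> \<rho> (so_of_ltl (LF \<phi>)) \<longleftrightarrow> (\<exists>k\<ge>\<sigma> 0. tsat (?T k) \<phi>)"
    by (simp add: F_frames_def LF)
  then show ?case by (auto simp: nat_le_iff_add)
next
  case (LG \<phi>)
  let ?T = "\<lambda>n. team (un3 (\<rho> 0 3)) (un1 (\<rho> 0 1)) n"
  have "asat \<sigma> \<rho> (so_of_ltl (LG \<phi>)) \<longleftrightarrow> (\<forall>k\<ge>\<sigma> 0. tsat (?T k) \<phi>)"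
    by (simp add: G_frames_def LG)
  then show ?case by (auto simp: nat_le_iff_add)
next
  case (LU \<phi> \<psi>)
  let ?T = "\<lambda>n. team (un3 (\<rho> 0 3)) (un1 (\<rho> 0 1)) n"
  have "asat \<sigma> \<rho> (so_of_ltl (LU \<phi> \<psi>)) \<longleftrightarrow>
    (\<exists>k\<ge>\<sigma> 0. (\<forall>j. \<sigma> 0 \<le> j \<and> j < k \<longrightarrow> tsat (?T j) \<phi>) \<and> tsat (?T k) \<psi>)"
    by (auto simp: U_frames_def U_left_frames_def before_def LU Suc_le_eq)
  also have "\<dots> \<longleftrightarrow> (\<exists>k. (\<forall>j<k. tsat (?T (\<sigma> 0 + j)) \<phi>) \<and> tsat (?T (\<sigma> 0 + k)) \<psi>)"
    by (rule until_shift)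
  finally show ?case by auto
next
  case (LR \<phi> \<psi>)
  let ?T = "\<lambda>n. team (un3 (\<rho> 0 3)) (un1 (\<rho> 0 1)) n"
  have "asat \<sigma> \<rho> (so_of_ltl (LR \<phi> \<psi>)) \<longleftrightarrow>
    (\<forall>k\<ge>\<sigma> 0. (\<exists>j. \<sigma> 0 \<le> j \<and> j < k \<and> tsat (?T j) \<phi>) \<or> tsat (?T k) \<psi>)"
    by (auto simp: R_frames_def R_left_frames_def before_def LR Suc_le_eq)
  also have "\<dots> \<longleftrightarrow> (\<forall>k. (\<exists>j<k. tsat (?T (\<sigma> 0 + j)) \<phi>) \<or> tsat (?T (\<sigma> 0 + k)) \<psi>)"
    by (rule release_shift)
  finally show ?case by auto
next
  case (LTilde \<phi>)
  then show ?case by simp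
qed

section \<open>Free variables of the translation\<close>

lemma fv1_bits: "fv1 (plugs (concat (map bit_frames bs)) atom_end) \<subseteq> {0, 4}"
  by (induction bs) (auto simp: atom_end_def bit_frames_def)

lemma fv2_bits: "fv2 (plugs (concat (map bit_frames bs)) atom_end) \<subseteq> {(0, 1), (0, 3)}"
  by (induction bs) (auto simp: atom_end_def bit_frames_def)

lemma pos_arities_bits: "pos_arities (plugs (concat (map bit_frames bs)) atom_end)"
  by (induction bs) (auto simp: atom_end_def bit_frames_def)

lemma fv1_so_of_ltl: "fv1 (so_of_ltl \<phi>) \<subseteq> {0}"
proof (induction \<phi>)
  case (LAtom p)
  show ?case using fv1_bits[of "bin p"] by (auto simp: atom_frames_def)
qed (auto simp: block_defs)

lemma fv2_so_of_ltl: "fv2 (so_of_ltl \<phi>) \<subseteq> {(0, 1), (0, 3)}"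
proof (induction \<phi>)
  case (LAtom p)
  show ?case using fv2_bits[of "bin p"] by (auto simp: atom_frames_def)
qed (auto simp: block_defs)

lemma pos_arities_so_of_ltl: "pos_arities (so_of_ltl \<phi>)"
proof (induction \<phi>)
  case (LAtom p)
  show ?case using pos_arities_bits[of "bin p"] by (simp add: atom_frames_def)
qed (simp_all add: block_defs)

text \<open>All that depends on the problem sits in the fixed prefix \<open>fs\<close>, which closes
  the translated formula and is written before the first letter is read.\<close>

lemma reduction:
  assumes "\<And>\<phi>. closed_so (plugs fs (so_of_ltl \<phi>))"
    and "\<And>\<phi>. asat (\<lambda>_. 0) (\<lambda>_ _. {}) (plugs fs (so_of_ltl \<phi>)) \<longleftrightarrow> \<phi> \<in> X"
  shows "logspace_reducible (enc_ltl ` X) (enc_so ` Delta20)"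
proof -
  have "w \<in> enc_ltl ` X \<longleftrightarrow> enc_frames fs @ tr w 0 \<in> enc_so ` Delta20" for w
  proof
    assume "w \<in> enc_ltl ` X"
    then obtain \<phi> where "w = enc_ltl \<phi>" "\<phi> \<in> X" by blast
    then have "enc_frames fs @ tr w 0 = enc_so (plugs fs (so_of_ltl \<phi>))"
      and "plugs fs (so_of_ltl \<phi>) \<in> Delta20"
      using tr_encodes_iff assms unfolding Delta20_def by blast+
    then show "enc_frames fs @ tr w 0 \<in> enc_so ` Delta20" by blast
  next
    assume "enc_frames fs @ tr w 0 \<in> enc_so ` Delta20"
    then obtain \<chi> where "enc_frames fs @ tr w 0 = enc_so \<chi>" "\<chi> \<in> Delta20" by blast
    then obtain \<phi> where "w = enc_ltl \<phi>" "plugs fs (so_of_ltl \<phi>) \<in> Delta20"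
      using tr_encodes_iff[of fs w \<chi>] by auto
    then show "w \<in> enc_ltl ` X" using assms(2) unfolding Delta20_def by blast
  qed
  then show ?thesis
    unfolding logspace_reducible_def
    by (intro exI[of _ "\<lambda>w. enc_frames fs @ tr w 0"] conjI allI tr_logspace)
qed

subsection \<open>Countable teams\<close>

primrec atoms :: "ltl \<Rightarrow> nat set" where
  "atoms (LAtom p) = {p}"
| "atoms (LNeg \<phi>) = atoms \<phi>"
| "atoms (LAnd \<phi> \<psi>) = atoms \<phi> \<union> atoms \<psi>"
| "atoms (LOr \<phi> \<psi>) = atoms \<phi> \<union> atoms \<psi>"
| "atoms (LX \<phi>) = atoms \<phi>"
| "atoms (LF \<phi>) = atoms \<phi>"
| "atoms (LG \<phi>) = atoms \<phi>"
| "atoms (LU \<phi> \<psi>) = atoms \<phi> \<union> atoms \<psi>"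
| "atoms (LR \<phi> \<psi>) = atoms \<phi> \<union> atoms \<psi>"
| "atoms (LTilde \<phi>) = atoms \<phi>"

lemma finite_atoms: "finite (atoms \<phi>)"
  by (induction \<phi>) auto

definition restr :: "nat set \<Rightarrow> trace \<Rightarrow> trace" where
  "restr P t n = t n \<inter> P"

lemma team_suffix_restr: "team_suffix k (restr P ` T) = restr P ` team_suffix k T"
  by (auto simp: team_suffix_def tsuffix_def restr_def image_iff fun_eq_iff)

lemma tsat_restr: "atoms \<phi> \<subseteq> P \<Longrightarrow> tsat (restr P ` T) \<phi> \<longleftrightarrow> tsat T \<phi>"
proof (induction \<phi> arbitrary: T)
  case (LAtom p)
  then show ?case by (auto simp: restr_def)
next
  case (LNeg \<phi>)
  have "tsat {restr P t} \<phi> \<longleftrightarrow> tsat {t} \<phi>" for t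
    using LNeg.IH[of "{t}"] LNeg.prems by simp
  then show ?case by simp
next
  case (LOr \<phi> \<psi>)
  then show ?case by (simp add: image_split_ex)
qed (simp_all add: team_suffix_restr)

lemma ultimately_constant_imp_periodic: "ultimately_constant t \<Longrightarrow> ultimately_periodic t"
proof -
  assume "ultimately_constant t"
  then obtain i where i: "\<forall>n\<ge>i. t n = t i" by (auto simp: ultimately_constant_def)
  show ?thesis
    unfolding ultimately_periodic_def
  proof (intro exI conjI allI impI)
    \<comment> \<open>\<open>Suc i\<close> in place of \<open>i\<close>, since the threshold must be
      positive.\<close>
    show "0 < Suc i" "0 < (1 :: nat)" by simp_all
    show "t n = t (n + 1)" if "n \<ge> Suc i" for n
      using i[rule_format, of n] i[rule_format, of "n + 1"] that by simp
  qed
qed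

text \<open>From \<open>c\<close> on only the residue modulo \<open>d\<close> matters, so the first
  \<open>c + d\<close> values determine the trace.\<close>

lemma periodic_determined:
  fixes t :: "nat \<Rightarrow> 'a"
  assumes "d > 0" "\<forall>n\<ge>c. t n = t (n + d)"
  shows "t n = map t [0..<c + d] ! (if n < c then n else c + (n - c) mod d)"
proof -
  have *: "t (c + k) = t (c + k mod d)" for k
  proof (induction k rule: less_induct)
    case (less k)
    show ?case
    proof (cases "k < d")
      case False
      have "t (c + k) = t (c + (k - d) + d)" using False by simp
      also have "\<dots> = t (c + (k - d))" by (rule assms(2)[rule_format, symmetric]) simp
      also have "\<dots> = t (c + (k - d) mod d)" using False assms(1) by (intro less.IH) simp
      also have "(k - d) mod d = k mod d" using False by (simp add: le_mod_geq)
      finally show ?thesis .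
    qed simp
  qed
  have "t n = t (c + (n - c) mod d)" if "n \<ge> c"
    using *[of "n - c"] that by simp
  then show ?thesis using assms(1) by (cases "n < c") simp_all
qed

text \<open>Two numbers and a finite list of labels decode each such trace. Finiteness of
  \<open>P\<close> enters through \<open>Pow P\<close>, the set of possible labels.\<close>

lemma countable_periodic:
  assumes "finite P"
  shows "countable {t. ultimately_periodic t \<and> (\<forall>n. t n \<subseteq> P)}" (is "countable ?S")
proof -
  define dec :: "nat \<times> nat \<times> nat set list \<Rightarrow> trace" where
    "dec = (\<lambda>(c, d, l) n. l ! (if n < c then n else c + (n - c) mod d))"
  have "?S \<subseteq> dec ` (UNIV \<times> UNIV \<times> lists (Pow P))"
  proof
    fix t assume "t \<in> ?S"
    then obtain c d where cd: "d > 0" "\<forall>n\<ge>c. t n = t (n + d)" and P: "\<forall>n. t n \<subseteq> P"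
      by (auto simp: ultimately_periodic_def)
    have "t = dec (c, d, map t [0..<c + d])"
      unfolding dec_def prod.case using periodic_determined[OF cd] by blast
    moreover have "map t [0..<c + d] \<in> lists (Pow P)"
      using P by (simp add: lists_eq_set image_subset_iff)
    ultimately show "t \<in> dec ` (UNIV \<times> UNIV \<times> lists (Pow P))" by blast
  qed
  moreover have "countable (Pow P)" using assms by (simp add: countable_finite)
  then have "countable (UNIV \<times> UNIV \<times> lists (Pow P) :: (nat \<times> nat \<times> nat set list) set)"
    by (intro countable_SIGMA countable_lists) auto
  ultimately show ?thesis by (meson countable_image countable_subset)
qed

lemma countable_iff_enumerated: "countable T \<longleftrightarrow> (\<exists>(A :: nat \<Rightarrow> 'a) I. T = A ` I)"
proof
  assume "countable T"
  then obtain f :: "'a \<Rightarrow> nat" where "inj_on f T" by (auto simp: countable_def)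
  then have "T = inv_into T f ` f ` T" by simp
  then show "\<exists>(A :: nat \<Rightarrow> 'a) I. T = A ` I" by blast
qed auto

subsection \<open>The three satisfiability problems\<close>

definition "team_frames D = [FEx2 0 3, FEx2 0 1, FAnd D, FEx1 0, FAnd (SEq (v 0) AZero)]"

text \<open>\<open>K\<close> depends on the team and not on its enumeration, so the quantifiers over
  \<open>A\<close> and \<open>I\<close> merge into one over countable teams.\<close>

lemma asat_team_frames:
  assumes "\<And>A I. asat \<sigma> (\<rho>(0 := (\<rho> 0)(3 := rel3 A, 1 := rel1 I))) D \<longleftrightarrow> K (A ` I)"
  shows "asat \<sigma> \<rho> (plugs (team_frames D) (so_of_ltl \<phi>)) \<longleftrightarrow> (\<exists>T. countable T \<and> K T \<and> tsat T \<phi>)"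
proof -
  have "asat \<sigma> \<rho> (plugs (team_frames D) (so_of_ltl \<phi>)) \<longleftrightarrow> (\<exists>A I. K (A ` I) \<and> tsat (team A I 0) \<phi>)"
    using assms by (simp add: team_frames_def asat_so_of_ltl)
  also have "\<dots> \<longleftrightarrow> (\<exists>(A :: nat \<Rightarrow> trace) I. K (A ` I) \<and> tsat (A ` I) \<phi>)"
    by (simp add: team_def tsuffix_def)
  finally show ?thesis by (auto simp: countable_iff_enumerated)
qed

lemma team_frames_vars:
  "fv1 (plugs (team_frames D) \<chi>) = fv1 D \<union> (fv1 \<chi> - {0})"
  "fv2 (plugs (team_frames D) \<chi>) = fv2 D \<union> fv2 \<chi> - {(0, 1), (0, 3)}"
  "pos_arities (plugs (team_frames D) \<chi>) \<longleftrightarrow> pos_arities D \<and> pos_arities \<chi>"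
  by (auto simp: team_frames_def)

definition "member_form = SEx1 3 (SAnd (SApp 0 [v 3])
  (SAll1 0 (SAll1 4 (SIff (SApp 0 [v 0, v 4]) (SApp 0 [v 3, v 0, v 4])))))"

lemma asat_member_form: "asat \<sigma> \<rho> member_form \<longleftrightarrow> un2 (\<rho> 0 2) \<in> un3 (\<rho> 0 3) ` un1 (\<rho> 0 1)"
  by (auto simp: member_form_def un1_def un2_def un3_def image_iff fun_eq_iff set_eq_iff)

definition "periodic_form = SEx1 1 (SEx1 2 (SAnd (SAnd (SLe AOne (v 1)) (SLe AOne (v 2)))
  (SAll1 0 (SImp (SLe (v 1) (v 0))
    (SAll1 4 (SIff (SApp 0 [v 0, v 4]) (SApp 0 [APlus (v 0) (v 2), v 4])))))))"

definition "constant_form = SEx1 1 (SAll1 0 (SImp (SLe (v 1) (v 0))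
  (SAll1 4 (SIff (SApp 0 [v 0, v 4]) (SApp 0 [v 1, v 4])))))"

lemma asat_periodic_form: "asat \<sigma> \<rho> periodic_form \<longleftrightarrow> ultimately_periodic (un2 (\<rho> 0 2))"
  by (simp add: periodic_form_def ultimately_periodic_def un2_def set_eq_iff Suc_le_eq)

lemma asat_constant_form: "asat \<sigma> \<rho> constant_form \<longleftrightarrow> ultimately_constant (un2 (\<rho> 0 2))"
  by (simp add: constant_form_def ultimately_constant_def un2_def set_eq_iff)

text \<open>A Kripke structure is given by its set of worlds \<open>(3, 1)\<close>, its edges \<open>(2, 2)\<close>, its labelling
  \<open>(3, 2)\<close> and its root \<open>v 6\<close>; \<open>(1, 2)\<close> is the graph of a path.\<close>

definition "kripke_form =
  SAnd (SEx1 5 (SAll1 4 (SImp (SApp 3 [v 4]) (SLe (v 4) (v 5)))))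
  (SAnd (SAll1 1 (SAll1 2 (SImp (SApp 2 [v 1, v 2]) (SAnd (SApp 3 [v 1]) (SApp 3 [v 2])))))
  (SAnd (SAll1 1 (SImp (SApp 3 [v 1]) (SEx1 2 (SApp 2 [v 1, v 2]))))
  (SAnd (SAll1 1 (SImp (SApp 3 [v 1]) (SEx1 5 (SAll1 4 (SImp (SApp 3 [v 1, v 4]) (SLe (v 4) (v 5)))))))
  (SApp 3 [v 6]))))"

definition "path_form = SEx2 1 2
  (SAnd (SAll1 0 (SEx1 1 (SAll1 2 (SIff (SApp 1 [v 0, v 2]) (SEq (v 2) (v 1))))))
  (SAnd (SApp 1 [AZero, v 6])
  (SAnd (SAll1 0 (SAll1 1 (SAll1 2 (SImp (SAnd (SApp 1 [v 0, v 1]) (SApp 1 [APlus (v 0) AOne, v 2])) (SApp 2 [v 1, v 2])))))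
  (SAll1 0 (SAll1 4 (SIff (SApp 0 [v 0, v 4]) (SEx1 2 (SAnd (SApp 1 [v 0, v 2]) (SApp 3 [v 2, v 4])))))))))"

text \<open>\<open>un2\<close> reads a relation as a map to successor sets; this returns to
  pairs.\<close>

definition edges :: "trace \<Rightarrow> (nat \<times> nat) set" where
  "edges t = {(w, u). u \<in> t w}"

text \<open>A set of numbers is finite iff it is bounded, which is first-order; the root makes the
  set of worlds nonempty.\<close>

lemma asat_kripke_form:
  "asat \<sigma> \<rho> kripke_form \<longleftrightarrow> kripke (un1 (\<rho> 3 1)) (edges (un2 (\<rho> 2 2))) (un2 (\<rho> 3 2)) (\<sigma> 6)"
proof -
  have "asat \<sigma> \<rho> kripke_form \<longleftrightarrow>
    (\<exists>N. \<forall>x\<in>un1 (\<rho> 3 1). x \<le> N) \<and>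
    (\<forall>w u. (w, u) \<in> edges (un2 (\<rho> 2 2)) \<longrightarrow> w \<in> un1 (\<rho> 3 1) \<and> u \<in> un1 (\<rho> 3 1)) \<and>
    (\<forall>w\<in>un1 (\<rho> 3 1). \<exists>u. (w, u) \<in> edges (un2 (\<rho> 2 2))) \<and>
    (\<forall>w\<in>un1 (\<rho> 3 1). \<exists>N. \<forall>x\<in>un2 (\<rho> 3 2) w. x \<le> N) \<and> \<sigma> 6 \<in> un1 (\<rho> 3 1)"
    by (simp add: kripke_form_def un1_def un2_def edges_def Ball_def)
  also have "(\<forall>w u. (w, u) \<in> edges (un2 (\<rho> 2 2)) \<longrightarrow> w \<in> un1 (\<rho> 3 1) \<and> u \<in> un1 (\<rho> 3 1)) \<longleftrightarrow>
      edges (un2 (\<rho> 2 2)) \<subseteq> un1 (\<rho> 3 1) \<times> un1 (\<rho> 3 1)"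
    by auto
  finally show ?thesis
    unfolding kripke_def finite_nat_set_iff_bounded_le by (metis (no_types) empty_iff)
qed

text \<open>Only relations can be quantified, so a path is a relation with exactly one value at each
  time, from which \<open>choice\<close> extracts the function.\<close>

lemma asat_path_form:
  "asat \<sigma> \<rho> path_form \<longleftrightarrow> un2 (\<rho> 0 2) \<in> kteam (edges (un2 (\<rho> 2 2))) (un2 (\<rho> 3 2)) (\<sigma> 6)"
  (is "_ \<longleftrightarrow> ?t \<in> kteam ?R ?E ?r")
proof -
  have "asat \<sigma> \<rho> path_form \<longleftrightarrow> (\<exists>P. (\<forall>n. \<exists>w. \<forall>u. u \<in> P n \<longleftrightarrow> u = w) \<and> ?r \<in> P 0 \<and>
    (\<forall>n w u. w \<in> P n \<and> u \<in> P (Suc n) \<longrightarrow> (w, u) \<in> ?R) \<and> (\<forall>n p. p \<in> ?t n \<longleftrightarrow> (\<exists>w. w \<in> P n \<and> p \<in> ?E w)))"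
    by (simp add: path_form_def un2_def edges_def)
  also have "\<dots> \<longleftrightarrow> (\<exists>\<pi>. \<pi> 0 = ?r \<and> (\<forall>n. (\<pi> n, \<pi> (Suc n)) \<in> ?R) \<and> ?t = (\<lambda>n. ?E (\<pi> n)))" (is "?lhs \<longleftrightarrow> ?rhs")
  proof
    assume ?lhs
    then obtain P where P: "\<forall>n. \<exists>w. \<forall>u. u \<in> P n \<longleftrightarrow> u = w" "?r \<in> P 0"
      "\<And>n w u. w \<in> P n \<Longrightarrow> u \<in> P (Suc n) \<Longrightarrow> (w, u) \<in> ?R"
      "\<And>n p. p \<in> ?t n \<longleftrightarrow> (\<exists>w. w \<in> P n \<and> p \<in> ?E w)" by blast
    obtain \<pi> where \<pi>: "\<And>n u. u \<in> P n \<longleftrightarrow> u = \<pi> n"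
      using choice[OF P(1)] by blast
    have "\<pi> 0 = ?r" using P(2) unfolding \<pi> by (rule sym)
    moreover have "(\<pi> n, \<pi> (Suc n)) \<in> ?R" for n
      by (rule P(3)[of _ n]) (simp_all only: \<pi>)
    moreover have "?t n = ?E (\<pi> n)" for n
      unfolding set_eq_iff P(4) \<pi> by blast
    ultimately show ?rhs by blast
  next
    assume ?rhs
    then obtain \<pi> where "\<pi> 0 = ?r" "\<forall>n. (\<pi> n, \<pi> (Suc n)) \<in> ?R" "?t = (\<lambda>n. ?E (\<pi> n))" by blast
    then show ?lhs
      by (intro exI[of _ "\<lambda>n. {\<pi> n}"] conjI) (simp_all, blast)
  qed
  finally show ?thesis by (auto simp: kteam_def kpaths_def)
qed

text \<open>Definability puts the class into the formula, periodicity gives countability, and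
  closure under restriction keeps cut-down teams inside the class.\<close>

locale trace_class =
  fixes C :: "trace set" and class_form :: soform
  assumes asat_class_form: "asat \<sigma> \<rho> class_form \<longleftrightarrow> un2 (\<rho> 0 2) \<in> C"
    and fv_class_form: "fv1 class_form = {}" "fv2 class_form = {(0, 2)}" "pos_arities class_form"
    and periodic: "C \<subseteq> {t. ultimately_periodic t}"
    and restr_closed: "t \<in> C \<Longrightarrow> restr P t \<in> C"
begin

definition "subclass_form = SAll2 0 2 (SImp member_form class_form)"
definition "kripke_team_form = SAll2 0 2 (SIff member_form (SAnd path_form class_form))"
definition "kripke_frames = [FEx2 3 1, FEx2 2 2, FEx2 3 2, FEx1 6, FAnd kripke_form]"

lemma asat_subclass_form: "asat \<sigma> \<rho> subclass_form \<longleftrightarrow> un3 (\<rho> 0 3) ` un1 (\<rho> 0 1) \<subseteq> C"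
  by (auto simp: subclass_form_def asat_member_form asat_class_form)

lemma asat_kripke_team_form:
  "asat \<sigma> \<rho> kripke_team_form \<longleftrightarrow>
    un3 (\<rho> 0 3) ` un1 (\<rho> 0 1) = kteam (edges (un2 (\<rho> 2 2))) (un2 (\<rho> 3 2)) (\<sigma> 6) \<inter> C"
  by (simp add: kripke_team_form_def asat_member_form asat_path_form asat_class_form set_eq_iff)

text \<open>A witness may be uncountable, but its restriction to the atoms of \<open>\<phi>\<close>
  is countable, stays in \<open>C\<close> and satisfies the same formula.\<close>

lemma restricted_sat_iff: "\<phi> \<in> restricted_sat C \<longleftrightarrow> (\<exists>T. countable T \<and> T \<subseteq> C \<and> tsat T \<phi>)"
proof
  assume "\<phi> \<in> restricted_sat C"
  then obtain T where T: "tsat (T \<inter> C) \<phi>" by (auto simp: restricted_sat_def)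
  let ?T = "restr (atoms \<phi>) ` (T \<inter> C)"
  have "?T \<subseteq> C" using restr_closed by auto
  moreover from this have "?T \<subseteq> {t. ultimately_periodic t \<and> (\<forall>n. t n \<subseteq> atoms \<phi>)}"
    using periodic by (auto simp: restr_def)
  then have "countable ?T" using countable_periodic[OF finite_atoms] countable_subset by blast
  moreover have "tsat ?T \<phi>" using T tsat_restr[OF order_refl] by blast
  ultimately show "\<exists>T. countable T \<and> T \<subseteq> C \<and> tsat T \<phi>" by blast
next
  assume "\<exists>T. countable T \<and> T \<subseteq> C \<and> tsat T \<phi>"
  then obtain T where "T \<inter> C = T" "tsat T \<phi>" by blast
  then have "tsat (T \<inter> C) \<phi>" by (simp only:)
  then show "\<phi> \<in> restricted_sat C" unfolding restricted_sat_def by blast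
qed

text \<open>The finitely many propositions labelling worlds form a finite alphabet. Labels stay
  untouched, as the coded team must equal this intersection exactly.\<close>

lemma countable_kteam:
  assumes "kripke W R \<eta> r"
  shows "countable (kteam R \<eta> r \<inter> C)"
proof -
  have "t n \<subseteq> \<Union> (\<eta> ` W)" if "t \<in> kteam R \<eta> r" for t n
  proof -
    from that obtain \<pi> where \<pi>: "t = (\<lambda>i. \<eta> (\<pi> i))" "\<pi> \<in> kpaths R r"
      unfolding kteam_def by blast
    then have "(\<pi> n, \<pi> (Suc n)) \<in> R" unfolding kpaths_def by blast
    then have "\<pi> n \<in> W" using assms unfolding kripke_def by blast
    then show ?thesis using \<pi>(1) by blast
  qed
  then have "kteam R \<eta> r \<inter> C \<subseteq> {t. ultimately_periodic t \<and> (\<forall>n. t n \<subseteq> \<Union> (\<eta> ` W))}"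
    using periodic by blast
  moreover have "finite (\<Union> (\<eta> ` W))" using assms by (simp add: kripke_def)
  ultimately show ?thesis using countable_subset[OF _ countable_periodic] by blast
qed

lemma restricted_fin_sat_iff:
  "\<phi> \<in> restricted_fin_sat C \<longleftrightarrow>
    (\<exists>W R \<eta> r. kripke W (edges R) \<eta> r \<and> (\<exists>T. countable T \<and> T = kteam (edges R) \<eta> r \<inter> C \<and> tsat T \<phi>))"
proof
  assume "\<phi> \<in> restricted_fin_sat C"
  then obtain W R \<eta> r where K: "kripke W R \<eta> r" "tsat (kteam R \<eta> r \<inter> C) \<phi>"
    unfolding restricted_fin_sat_def by blast
  \<comment> \<open>Every relation comes from a successor map, so quantifying over
    \<open>edges R\<close> loses nothing.\<close>
  have R: "edges (\<lambda>w. {u. (w, u) \<in> R}) = R" by (auto simp: edges_def)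
  show "\<exists>W R \<eta> r. kripke W (edges R) \<eta> r \<and> (\<exists>T. countable T \<and> T = kteam (edges R) \<eta> r \<inter> C \<and> tsat T \<phi>)"
  proof (intro exI conjI)
    show "kripke W (edges (\<lambda>w. {u. (w, u) \<in> R})) \<eta> r"
      and "tsat (kteam (edges (\<lambda>w. {u. (w, u) \<in> R})) \<eta> r \<inter> C) \<phi>"
      and "countable (kteam (edges (\<lambda>w. {u. (w, u) \<in> R})) \<eta> r \<inter> C)"
      unfolding R by (rule K countable_kteam[OF K(1)])+
  qed (rule refl)
qed (unfold restricted_fin_sat_def, blast)

lemma form_vars:
  "fv1 subclass_form = {}" "fv2 subclass_form \<subseteq> {(0, 1), (0, 3)}" "pos_arities subclass_form"
  "fv1 kripke_form = {6}" "fv2 kripke_form \<subseteq> {(3, Suc 0), (2, 2), (3, 2)}" "pos_arities kripke_form"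
  "fv1 kripke_team_form = {6}" "fv2 kripke_team_form \<subseteq> {(0, 1), (0, 3), (2, 2), (3, 2)}"
  "pos_arities kripke_team_form"
  by (simp_all add: subclass_form_def kripke_form_def kripke_team_form_def member_form_def path_form_def
      fv_class_form, auto)

lemma closed_kripke_frames:
  assumes "fv1 \<chi> \<subseteq> {6}" "fv2 \<chi> \<subseteq> {(2, 2), (3, 2)}" "pos_arities \<chi>"
  shows "closed_so (plugs kripke_frames \<chi>)"
proof -
  have "fv1 (plugs kripke_frames \<chi>) = fv1 kripke_form \<union> fv1 \<chi> - {6}"
    by (simp add: kripke_frames_def)
  then have 1: "fv1 (plugs kripke_frames \<chi>) = {}"
    using assms(1) unfolding form_vars by auto
  have *: "S - {c} - {b} - {a} = {}" if "S \<subseteq> {a, b, c}" for S and a b c :: "nat \<times> nat"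
    using that by auto
  have "fv2 (plugs kripke_frames \<chi>) = fv2 kripke_form \<union> fv2 \<chi> - {(3, 2)} - {(2, 2)} - {(3, Suc 0)}"
    by (simp add: kripke_frames_def)
  moreover have "fv2 kripke_form \<union> fv2 \<chi> \<subseteq> {(3, Suc 0), (2, 2), (3, 2)}"
    using assms(2) form_vars(5) by (simp add: subset_insertI2)
  ultimately have 2: "fv2 (plugs kripke_frames \<chi>) = {}"
    using *[of "fv2 kripke_form \<union> fv2 \<chi>"] by simp
  have "pos_arities (plugs kripke_frames \<chi>)"
    using assms(3) form_vars(6) by (simp add: kripke_frames_def)
  with 1 2 show ?thesis by (simp add: closed_so_def)
qed

lemma restricted_reducible: "logspace_reducible (enc_ltl ` restricted_sat C) (enc_so ` Delta20)"
proof (rule reduction)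
  show "closed_so (plugs (team_frames subclass_form) (so_of_ltl \<phi>))" for \<phi>
    unfolding closed_so_def team_frames_vars
    using fv1_so_of_ltl[of \<phi>] fv2_so_of_ltl[of \<phi>] pos_arities_so_of_ltl[of \<phi>] form_vars(1-3) by blast
  show "asat (\<lambda>_. 0) (\<lambda>_ _. {}) (plugs (team_frames subclass_form) (so_of_ltl \<phi>)) \<longleftrightarrow> \<phi> \<in> restricted_sat C" for \<phi>
    unfolding restricted_sat_iff by (rule asat_team_frames) (simp add: asat_subclass_form)
qed

text \<open>The structure is quantified outside the team, so that the condition on the team can
  refer to it.\<close>

lemma restricted_fin_reducible: "logspace_reducible (enc_ltl ` restricted_fin_sat C) (enc_so ` Delta20)"
proof (rule reduction)
  show "closed_so (plugs (kripke_frames @ team_frames kripke_team_form) (so_of_ltl \<phi>))" for \<phi>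
    unfolding plugs_append
    by (rule closed_kripke_frames; unfold team_frames_vars)
      (use fv1_so_of_ltl[of \<phi>] fv2_so_of_ltl[of \<phi>] pos_arities_so_of_ltl[of \<phi>] form_vars(7-9) in blast)+
  have team: "asat \<sigma> \<rho> (plugs (team_frames kripke_team_form) (so_of_ltl \<phi>)) \<longleftrightarrow>
    (\<exists>T. countable T \<and> T = kteam (edges (un2 (\<rho> 2 2))) (un2 (\<rho> 3 2)) (\<sigma> 6) \<inter> C \<and> tsat T \<phi>)" for \<sigma> \<rho> \<phi>
    by (rule asat_team_frames) (simp add: asat_kripke_team_form)
  show "asat (\<lambda>_. 0) (\<lambda>_ _. {}) (plugs (kripke_frames @ team_frames kripke_team_form) (so_of_ltl \<phi>)) \<longleftrightarrow>
      \<phi> \<in> restricted_fin_sat C" for \<phi>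
    unfolding restricted_fin_sat_iff by (simp add: kripke_frames_def asat_kripke_form team)
qed

end

lemma countable_reducible: "logspace_reducible (enc_ltl ` countable_sat) (enc_so ` Delta20)"
proof (rule reduction)
  \<comment> \<open>A trivially true condition: a team listed by indices is countable
    anyway.\<close>
  let ?D = "SEq AZero AZero"
  show "closed_so (plugs (team_frames ?D) (so_of_ltl \<phi>))" for \<phi>
    unfolding closed_so_def team_frames_vars
    using fv1_so_of_ltl[of \<phi>] fv2_so_of_ltl[of \<phi>] pos_arities_so_of_ltl[of \<phi>] by auto
  show "asat (\<lambda>_. 0) (\<lambda>_ _. {}) (plugs (team_frames ?D) (so_of_ltl \<phi>)) \<longleftrightarrow> \<phi> \<in> countable_sat" for \<phi>
    using asat_team_frames[of "\<lambda>_. 0" "\<lambda>_ _. {}" ?D "\<lambda>_. True"] by (simp add: countable_sat_def)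
qed

interpretation ultimately_periodic: trace_class "{t. ultimately_periodic t}" periodic_form
proof
  show "restr P t \<in> {t. ultimately_periodic t}" if "t \<in> {t. ultimately_periodic t}" for P t
    using that unfolding ultimately_periodic_def restr_def mem_Collect_eq by metis
qed (auto simp: asat_periodic_form, auto simp: periodic_form_def)

interpretation ultimately_constant: trace_class "{t. ultimately_constant t}" constant_form
proof
  show "restr P t \<in> {t. ultimately_constant t}" if "t \<in> {t. ultimately_constant t}" for P t
    using that unfolding ultimately_constant_def restr_def mem_Collect_eq by metis
qed (auto simp: asat_constant_form ultimately_constant_imp_periodic, auto simp: constant_form_def)

theorem mainTheorem12:
  assumes "C = {t. ultimately_periodic t} \<or> C = {t. ultimately_constant t}"
  shows "logspace_reducible (enc_ltl ` countable_sat) (enc_so ` Delta20)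
       \<and> logspace_reducible (enc_ltl ` restricted_sat C) (enc_so ` Delta20)
       \<and> logspace_reducible (enc_ltl ` restricted_fin_sat C) (enc_so ` Delta20)"
  using assms countable_reducible
    ultimately_periodic.restricted_reducible ultimately_periodic.restricted_fin_reducible
    ultimately_constant.restricted_reducible ultimately_constant.restricted_fin_reducible
  by blast

end
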